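(* Let $F\in\mathcal{F}[a,b]$, and let $\{\mathcal{K}_n\}_{n\in\mathbb{N}}$, $\mathcal{K}_n:[a,b]\times[a,b]\to\mathbb{R}$, be a sequence of kernels such that $\mathcal{K}_n(x,\cdot)$ is of bounded variation on $[a,b]$ for every $x\in[a,b]$ and every $n$. Let $T_nF$, $A_F$, $\alpha_n$, $\beta_n$, $M$ be as defined in the context. Then for any $x\in(a,b)$ the following hold. (i) For all $\delta>0$ and $n\in\mathbb{N}$, $$\mathrm{haus}\big(T_nF(x),A_F(x)\big)\le 2\,\varpi(v_F,x,2\delta)\,M(x)+\|F\|_\infty\Big(4\beta_n(x,\delta)+\alpha_n(x)+\big|T_n(\mathrm{sign}(\cdot-x))(x)\big|\Big).$$ (ii) If $\lim_{n\to\infty}\alpha_n(x)=0$, $\lim_{n\to\infty}\beta_n(x,\delta)=0$ for all sufficiently small $\delta>0$, $\lim_{n\to\infty}T_n(\mathrm{sign}(\cdot-x))(x)=0$, and $M(x)<\infty$, then $$\lim_{n\to\infty}\mathrm{haus}\big(T_nF(x),A_F(x)\big)=0.$$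
   Context: Fix a norm $|\cdot|$ on $\mathbb{R}^d$ and $[a,b]\subset\mathbb{R}$. $\mathrm{K}(\mathbb{R}^d)$ is the collection of non-empty compact subsets of $\mathbb{R}^d$ with the Hausdorff metric $\mathrm{haus}$ induced by $|\cdot|$; $|A|=\mathrm{haus}(A,\{0\})$. Metric pairs and chains: for $A,B\in\mathrm{K}(\mathbb{R}^d)$ and $y\in\mathbb{R}^d$, $\Pi_B(y)=\{b\in B: |y-b|=\mathrm{dist}(y,B)\}$ and $\Pi(A,B)=\{(p,q)\in A\times B: p\in\Pi_A(q)\text{ or }q\in\Pi_B(p)\}$. $\mathrm{CH}(A_0,\dots,A_n)=\{(y_0,\dots,y_n): (y_i,y_{i+1})\in\Pi(A_i,A_{i+1}),\ i=0,\dots,n-1\}$ is the set of metric chains. Variation: for $F:[a,b]\to \mathrm{K}(\mathbb{R}^d)$, $V_a^b(F)=\sup\sum_i \mathrm{haus}(F(x_i),F(x_{i-1}))$ over all partitions of $[a,b]$; $F$ is of bounded variation if $V_a^b(F)<\infty$; $v_F(x)=V_a^x(F)$, $x\in[a,b]$. $\|F\|_\infty=\sup_{x\in[a,b]}|F(x)|$. $\mathcal{F}[a,b]$ is the class of all $F:[a,b]\to\mathrm{K}(\mathbb{R}^d)$ of bounded variation whose graph $\{(x,y): x\in[a,b],\ y\in F(x)\}$ is compact. Metric selections: for a partition $\chi=\{a=x_0<\dots<x_n=b\}$ with $|\chi|=\max_i(x_{i+1}-x_i)$ and $\phi=(y_0,\dots,y_n)\in\mathrm{CH}(F(x_0),\dots,F(x_n))$,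 the chain function is $c_{\chi,\phi}(x)=y_i$ for $x\in[x_i,x_{i+1})$, $i=0,\dots,n-1$, and $c_{\chi,\phi}(x_n)=y_n$. A function $s:[a,b]\to\mathbb{R}^d$ with $s(x)\in F(x)$ for all $x$ is a metric selection of $F$ if it is the pointwise limit on $[a,b]$ of a sequence of chain functions $c_{\chi_k,\phi_k}$ of $F$ with $|\chi_k|\to0$. $\mathcal{S}(F)$ is the set of all metric selections of $F$. (Metric selections of $F\in\mathcal{F}[a,b]$ are of bounded variation, so one-sided limits $s(x\pm)$ exist.) For $x\in(a,b)$, $$A_F(x)=\left\{\tfrac12\big(s(x+)+s(x-)\big): s\in\mathcal{S}(F)\right\}.$$ Local quasi-moduli: for a function $f$ of bounded variation on $[a,b]$ and $x\in(a,b)$, $\varpi^-(f,x,\delta)=\sup\{|f(x-)-f(z)|: z\in[x-\delta,x)\cap[a,b]\}$, $\varpi^+(f,x,\delta)=\sup\{|f(x+)-f(z)|: z\in(x,x+\delta]\cap[a,b]\}$, $\varpi=\max\{\varpi^-,\varpi^+\}$. Weighted metric integral: for $\kappa:[a,b]\to\mathbb{R}$ and a partition $\chi=\{a=x_0<\dots<x_n=b\}$ with $|\chi|=\max_i(x_{i+1}-x_i)$, let $S_\chi^{\kappa}F=\{\sum_{i=0}^{n-1}(x_{i+1}-x_i)\kappa(x_i)y_i: (y_0,\dots,y_{n-1})\in\mathrm{CH}(F(x_0),\dots,F(x_{n-1}))\}$. The weighted metric integral $(\mathcal{M}_\kappa)\int_a^b\kappa(t)F(t)\,dt$ is the upper Kuratowski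 limit of $S_\chi^\kappa F$ as $|\chi|\to0$, i.e. the set of all limits of convergent sequences $z_k\in S_{\chi_k}^\kappa F$ with $|\chi_k|\to0$. Operators: with $\kappa_{n,x}(t)=\mathcal{K}_n(x,t)$, $T_nF(x)=(\mathcal{M}_{\kappa_{n,x}})\int_a^b\kappa_{n,x}(t)F(t)\,dt$; for real-valued $f$, $T_nf(x)=\int_a^b\mathcal{K}_n(x,t)f(t)\,dt$, so $T_n(\mathrm{sign}(\cdot-x))(x)=\int_a^b\mathcal{K}_n(x,t)\,\mathrm{sign}(t-x)\,dt$, where $\mathrm{sign}$ is $1,0,-1$ on positive, zero, negative arguments. Further notation: $\alpha_n(x)=\left|\int_a^b\mathcal{K}_n(x,t)\,dt-1\right|$; $\beta_n(x,\delta)=\int_{\{t\in[a,b]:|x-t|\ge\delta\}}|\mathcal{K}_n(x,t)|\,dt$ for $\delta>0$; and for each $x\in[a,b]$, $M(x)\in[0,\infty]$ is such that $\int_a^b|\mathcal{K}_n(x,t)|\,dt\le M(x)$ for all $n\in\mathbb{N}$. *)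

theory Defs
  imports "HOL-Analysis.Analysis"
begin

text \<open>
  \<open>\<real>\<^sup>d\<close> is a Euclidean space \<open>'a\<close>, and the fixed norm \<open>|\<cdot>|\<close> is an arbitrary function \<open>N\<close> on it that
  satisfies the norm axioms. Distances are measured with \<open>N\<close>; compactness and convergence refer to
  the topology of \<open>'a\<close>, which every norm on \<open>'a\<close> induces.
\<close>

definition is_norm :: "('a::real_vector \<Rightarrow> real) \<Rightarrow> bool" where
  "is_norm N \<longleftrightarrow>
     (\<forall>x. N x = 0 \<longleftrightarrow> x = 0) \<and>
     (\<forall>c x. N (c *\<^sub>R x) = \<bar>c\<bar> * N x) \<and>
     (\<forall>x y. N (x + y) \<le> N x + N y)"

definition point_dist :: "('a::real_vector \<Rightarrow> real) \<Rightarrow> 'a \<Rightarrow> 'a set \<Rightarrow> real" where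
  "point_dist N y B = (INF b\<in>B. N (y - b))"

definition haus :: "('a::real_vector \<Rightarrow> real) \<Rightarrow> 'a set \<Rightarrow> 'a set \<Rightarrow> real" where
  "haus N A B = max (SUP p\<in>A. point_dist N p B) (SUP q\<in>B. point_dist N q A)"

definition proj_set :: "('a::real_vector \<Rightarrow> real) \<Rightarrow> 'a set \<Rightarrow> 'a \<Rightarrow> 'a set" where
  "proj_set N B y = {b \<in> B. N (y - b) = point_dist N y B}"

definition metric_pairs :: "('a::real_vector \<Rightarrow> real) \<Rightarrow> 'a set \<Rightarrow> 'a set \<Rightarrow> ('a \<times> 'a) set" where
  "metric_pairs N A B = {(p, q). p \<in> A \<and> q \<in> B \<and> (p \<in> proj_set N A q \<or> q \<in> proj_set N B p)}"

text \<open>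
  \<open>metric_chain N n A y\<close> says \<open>(y 0, \<dots>, y n) \<in> CH(A 0, \<dots>, A n)\<close>. Membership \<open>y i \<in> A i\<close> is
  redundant for \<open>n \<ge> 1\<close> and makes \<open>CH(A 0) = A 0\<close> for \<open>n = 0\<close>.
\<close>

definition metric_chain ::
    "('a::real_vector \<Rightarrow> real) \<Rightarrow> nat \<Rightarrow> (nat \<Rightarrow> 'a set) \<Rightarrow> (nat \<Rightarrow> 'a) \<Rightarrow> bool" where
  "metric_chain N n A y \<longleftrightarrow>
     (\<forall>i\<le>n. y i \<in> A i) \<and> (\<forall>i<n. (y i, y (Suc i)) \<in> metric_pairs N (A i) (A (Suc i)))"

text \<open>
  A partition \<open>a = p 0 < \<dots> < p n = b\<close>. It has \<open>n = 0\<close> exactly when \<open>a = b\<close>.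
\<close>

definition is_partition :: "real \<Rightarrow> real \<Rightarrow> nat \<Rightarrow> (nat \<Rightarrow> real) \<Rightarrow> bool" where
  "is_partition a b n p \<longleftrightarrow> p 0 = a \<and> p n = b \<and> (\<forall>i<n. p i < p (Suc i))"

definition mesh :: "nat \<Rightarrow> (nat \<Rightarrow> real) \<Rightarrow> real" where
  "mesh n p = Max ((\<lambda>i. p (Suc i) - p i) ` {..<n})"

text \<open>
  Variation with respect to a distance function \<open>D\<close>: \<open>D = haus N\<close> for set-valued functions,
  \<open>D = dist\<close> for real-valued ones. \<open>variation\<close> is the real supremum, hence meaningful only under
  \<open>bounded_variation\<close>.
\<close>

definition variation_sums :: "('c \<Rightarrow> 'c \<Rightarrow> real) \<Rightarrow> real \<Rightarrow> real \<Rightarrow> (real \<Rightarrow> 'c) \<Rightarrow> real set" where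
  "variation_sums D a b f = {\<Sum>i<n. D (f (p (Suc i))) (f (p i)) | n p. is_partition a b n p}"

definition bounded_variation :: "('c \<Rightarrow> 'c \<Rightarrow> real) \<Rightarrow> real \<Rightarrow> real \<Rightarrow> (real \<Rightarrow> 'c) \<Rightarrow> bool" where
  "bounded_variation D a b f \<longleftrightarrow> bdd_above (variation_sums D a b f)"

definition variation :: "('c \<Rightarrow> 'c \<Rightarrow> real) \<Rightarrow> real \<Rightarrow> real \<Rightarrow> (real \<Rightarrow> 'c) \<Rightarrow> real" where
  "variation D a b f = Sup (variation_sums D a b f)"

definition var_fun :: "('a::real_vector \<Rightarrow> real) \<Rightarrow> real \<Rightarrow> (real \<Rightarrow> 'a set) \<Rightarrow> real \<Rightarrow> real" where
  "var_fun N a F x = variation (haus N) a x F"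

definition sup_norm :: "('a::real_vector \<Rightarrow> real) \<Rightarrow> real \<Rightarrow> real \<Rightarrow> (real \<Rightarrow> 'a set) \<Rightarrow> real" where
  "sup_norm N a b F = (SUP x\<in>{a..b}. haus N (F x) {0})"

text \<open>The class \<open>\<F>[a,b]\<close>; values of \<open>F\<close> outside \<open>[a,b]\<close> are irrelevant.\<close>

definition class_F ::
    "('a::euclidean_space \<Rightarrow> real) \<Rightarrow> real \<Rightarrow> real \<Rightarrow> (real \<Rightarrow> 'a set) set" where
  "class_F N a b =
     {F. (\<forall>x\<in>{a..b}. F x \<noteq> {} \<and> compact (F x)) \<and>
         bounded_variation (haus N) a b F \<and>
         compact {(x, y). x \<in> {a..b} \<and> y \<in> F x}}"

definition chain_fun :: "nat \<Rightarrow> (nat \<Rightarrow> real) \<Rightarrow> (nat \<Rightarrow> 'a) \<Rightarrow> real \<Rightarrow> 'a" where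
  "chain_fun n p y t =
     (if t = p n then y n else y (THE i. i < n \<and> p i \<le> t \<and> t < p (Suc i)))"

definition metric_selections ::
    "('a::euclidean_space \<Rightarrow> real) \<Rightarrow> real \<Rightarrow> real \<Rightarrow> (real \<Rightarrow> 'a set) \<Rightarrow> (real \<Rightarrow> 'a) set" where
  "metric_selections N a b F =
     {s. (\<forall>t\<in>{a..b}. s t \<in> F t) \<and>
         (\<exists>n p y.
            (\<forall>k. is_partition a b (n k) (p k) \<and> metric_chain N (n k) (\<lambda>i. F (p k i)) (y k)) \<and>
            (\<lambda>k. mesh (n k) (p k)) \<longlonglongrightarrow> 0 \<and>
            (\<forall>t\<in>{a..b}. (\<lambda>k. chain_fun (n k) (p k) (y k) t) \<longlonglongrightarrow> s t))}"

definition A_set ::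
    "('a::euclidean_space \<Rightarrow> real) \<Rightarrow> real \<Rightarrow> real \<Rightarrow> (real \<Rightarrow> 'a set) \<Rightarrow> real \<Rightarrow> 'a set" where
  "A_set N a b F x =
     {(1/2) *\<^sub>R (Lim (at_right x) s + Lim (at_left x) s) | s. s \<in> metric_selections N a b F}"

definition quasi_modulus_left :: "real \<Rightarrow> real \<Rightarrow> (real \<Rightarrow> real) \<Rightarrow> real \<Rightarrow> real \<Rightarrow> real" where
  "quasi_modulus_left a b f x \<delta> =
     (SUP z\<in>{x - \<delta>..<x} \<inter> {a..b}. \<bar>Lim (at_left x) f - f z\<bar>)"

definition quasi_modulus_right :: "real \<Rightarrow> real \<Rightarrow> (real \<Rightarrow> real) \<Rightarrow> real \<Rightarrow> real \<Rightarrow> real" where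
  "quasi_modulus_right a b f x \<delta> =
     (SUP z\<in>{x<..x + \<delta>} \<inter> {a..b}. \<bar>Lim (at_right x) f - f z\<bar>)"

definition quasi_modulus :: "real \<Rightarrow> real \<Rightarrow> (real \<Rightarrow> real) \<Rightarrow> real \<Rightarrow> real \<Rightarrow> real" where
  "quasi_modulus a b f x \<delta> = max (quasi_modulus_left a b f x \<delta>) (quasi_modulus_right a b f x \<delta>)"

text \<open>
  Here the chains run over \<open>F (p 0), \<dots>, F (p (n - 1))\<close>, without the last node \<open>p n = b\<close>.
\<close>

definition weighted_sums ::
    "('a::real_vector \<Rightarrow> real) \<Rightarrow> (real \<Rightarrow> real) \<Rightarrow> (real \<Rightarrow> 'a set) \<Rightarrow> nat \<Rightarrow> (nat \<Rightarrow> real) \<Rightarrow> 'a set" where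
  "weighted_sums N \<kappa> F n p =
     {\<Sum>i<n. ((p (Suc i) - p i) * \<kappa> (p i)) *\<^sub>R y i | y. metric_chain N (n - 1) (\<lambda>i. F (p i)) y}"

definition weighted_metric_integral ::
    "('a::euclidean_space \<Rightarrow> real) \<Rightarrow> real \<Rightarrow> real \<Rightarrow> (real \<Rightarrow> real) \<Rightarrow> (real \<Rightarrow> 'a set) \<Rightarrow> 'a set" where
  "weighted_metric_integral N a b \<kappa> F =
     {l. \<exists>n p z.
           (\<forall>k. is_partition a b (n k) (p k) \<and> z k \<in> weighted_sums N \<kappa> F (n k) (p k)) \<and>
           (\<lambda>k. mesh (n k) (p k)) \<longlonglongrightarrow> 0 \<and> z \<longlonglongrightarrow> l}"

text \<open>
  In the following, \<open>K n x t\<close> is the kernel \<open>\<K>\<^sub>n(x,t)\<close>. The integrands are of bounded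
  variation in \<open>t\<close> (on finitely many intervals), so that the Riemann, Lebesgue and
  Henstock-Kurzweil integrals coincide.
\<close>

definition T_set ::
    "('a::euclidean_space \<Rightarrow> real) \<Rightarrow> real \<Rightarrow> real \<Rightarrow> (nat \<Rightarrow> real \<Rightarrow> real \<Rightarrow> real) \<Rightarrow> nat
      \<Rightarrow> (real \<Rightarrow> 'a set) \<Rightarrow> real \<Rightarrow> 'a set" where
  "T_set N a b K n F x = weighted_metric_integral N a b (\<lambda>t. K n x t) F"

definition T_real ::
    "real \<Rightarrow> real \<Rightarrow> (nat \<Rightarrow> real \<Rightarrow> real \<Rightarrow> real) \<Rightarrow> nat \<Rightarrow> (real \<Rightarrow> real) \<Rightarrow> real \<Rightarrow> real" where
  "T_real a b K n f x = integral {a..b} (\<lambda>t. K n x t * f t)"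

definition alpha ::
    "real \<Rightarrow> real \<Rightarrow> (nat \<Rightarrow> real \<Rightarrow> real \<Rightarrow> real) \<Rightarrow> nat \<Rightarrow> real \<Rightarrow> real" where
  "alpha a b K n x = \<bar>integral {a..b} (\<lambda>t. K n x t) - 1\<bar>"

definition beta ::
    "real \<Rightarrow> real \<Rightarrow> (nat \<Rightarrow> real \<Rightarrow> real \<Rightarrow> real) \<Rightarrow> nat \<Rightarrow> real \<Rightarrow> real \<Rightarrow> real" where
  "beta a b K n x \<delta> = integral {t \<in> {a..b}. \<bar>x - t\<bar> \<ge> \<delta>} (\<lambda>t. \<bar>K n x t\<bar>)"

end

(*
  The weighted metric integral of F with kernel k is the set of integrals of k s over the metric
  selections s of F. A chain function oscillates no more than the variation function v_F does, up to
  a shift by the mesh of its partition, so Helly's selection principle gives pointwise convergent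
  subsequences, and dominated convergence passes to the limit in the Riemann sums. For a single
  selection s, comparing s with the two-valued step function s(x-), s(x+) bounds the distance of the
  integral of k s to (s(x+) + s(x-))/2 uniformly in s, hence the Hausdorff distance.
*)
theory Submission
  imports Defs "HOL-Complex_Analysis.Great_Picard"
begin

text \<open>The obstacle is the shift by the mesh. In the limit it survives as an arbitrary
  \<epsilon> > 0: a selection satisfies
  \<open>N (s t - s t') \<le> v t - v (max a (t' - \<epsilon>))\<close> for
  \<open>t' \<le> t\<close>, and \<epsilon> = 0 would be false. On the real line let
  \<open>F\<close> be {0} before \<open>t'\<close> and {0, 1} from \<open>t'\<close> on: chains
  whose nodes avoid \<open>t'\<close> converge to a selection that is 0 at \<open>t'\<close> and 1
  after it, although \<open>v\<close> is constant from \<open>t'\<close> on. Hence pointwise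
  convergence spreads only to continuity points of \<open>v\<close>; the exceptional points are
  countable because \<open>v\<close> is monotone, and a diagonal sequence settles them directly.
  Hence also the two sides of \<open>x\<close> differ: on the right the shifted point can be kept
  beyond \<open>x\<close>, on the left the shift moves it away from \<open>x\<close>. Limits of
  chain values stay in \<open>F\<close> because the graph is closed. The remainder after subtracting
  the step function is at most the modulus near \<open>x\<close> and at most \<open>2 * B\<close>
  elsewhere, so the estimate comes out with the constants 1 and 2 where the theorem states 2 and
  4.\<close>

section \<open>An arbitrary norm on a Euclidean space\<close>

locale norm_on =
  fixes N :: "'a::euclidean_space \<Rightarrow> real"
  assumes is_norm: "is_norm N"
begin

lemma N_0 [simp]: "N 0 = 0"
  and N_eq_0 [simp]: "N y = 0 \<longleftrightarrow> y = 0"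
  and N_scaleR: "N (c *\<^sub>R y) = \<bar>c\<bar> * N y"
  and N_add: "N (y + z) \<le> N y + N z"
  using is_norm unfolding is_norm_def by auto

lemma N_minus [simp]: "N (- y) = N y"
  using N_scaleR[of "-1" y] by simp

lemma N_diff_commute: "N (y - z) = N (z - y)"
  by (metis N_minus minus_diff_eq)

lemma N_nonneg [simp]: "0 \<le> N y"
  using N_add[of y "- y"] by simp

lemma N_diff: "N (y - z) \<le> N y + N z"
  using N_add[of y "- z"] by simp

lemma N_diff_triangle: "N (y - z) \<le> N (y - u) + N (u - z)"
  using N_add[of "y - u" "u - z"] by simp

lemma N_abs_diff: "\<bar>N y - N z\<bar> \<le> N (y - z)"
  using N_add[of "y - z" z] N_add[of "z - y" y] N_diff_commute[of y z] by auto

lemma N_sum: "N (sum f S) \<le> (\<Sum>i\<in>S. N (f i))"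
  by (induction S rule: infinite_finite_induct) (auto intro: order_trans[OF N_add])

text \<open>One half of the equivalence of norms, by expansion in the orthonormal basis. The summand
  1 in the constant makes its positivity immediate.\<close>

lemma N_le_norm: obtains C where "0 < C" "\<And>y. N y \<le> C * norm y"
proof
  let ?C = "1 + (\<Sum>i\<in>Basis. N i)"
  show "0 < ?C"
    by (simp add: add_pos_nonneg sum_nonneg)
  fix y
  have "N y = N (\<Sum>i\<in>Basis. (y \<bullet> i) *\<^sub>R i)"
    by (simp add: euclidean_representation)
  also have "\<dots> \<le> (\<Sum>i\<in>Basis. \<bar>y \<bullet> i\<bar> * N i)"
    using N_sum[of "\<lambda>i. (y \<bullet> i) *\<^sub>R i" Basis] by (simp add: N_scaleR)
  also have "\<dots> \<le> (\<Sum>i\<in>Basis. norm y * N i)"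
    by (intro sum_mono mult_right_mono) (auto simp: Basis_le_norm)
  also have "\<dots> \<le> ?C * norm y"
    by (simp add: sum_distrib_left algebra_simps)
  finally show "N y \<le> ?C * norm y" .
qed

lemma continuous_on_N: "continuous_on S N"
proof -
  obtain C where C: "0 < C" "\<And>y. N y \<le> C * norm y"
    using N_le_norm by blast
  have "C-lipschitz_on S N"
    using C(1) order_trans[OF N_abs_diff C(2)]
    by (intro lipschitz_onI) (simp_all add: dist_real_def dist_norm)
  then show ?thesis
    by (rule lipschitz_on_continuous_on)
qed

lemma continuous_on_N' [continuous_intros]: "continuous_on S f \<Longrightarrow> continuous_on S (\<lambda>u. N (f u))"
  by (rule continuous_on_compose2[OF continuous_on_N[of UNIV]]) auto

lemma tendsto_N: "(f \<longlongrightarrow> l) G \<Longrightarrow> ((\<lambda>u. N (f u)) \<longlongrightarrow> N l) G"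
  by (rule continuous_on_tendsto_compose[OF continuous_on_N[of UNIV]]) auto

text \<open>The other half: \<open>N\<close> attains a positive minimum on the compact unit sphere,
  and homogeneity does the rest.\<close>

lemma norm_le_N: obtains c where "0 < c" "\<And>y. norm y \<le> c * N y"
proof -
  have ne: "sphere (0::'a) 1 \<noteq> {}"
    by simp
  obtain u where u: "u \<in> sphere 0 1" "\<And>y. y \<in> sphere 0 1 \<Longrightarrow> N u \<le> N y"
    using continuous_attains_inf[OF compact_sphere ne continuous_on_N] by blast
  have u0: "0 < N u"
    using u(1) N_nonneg[of u] N_eq_0[of u] by (auto simp: less_le)
  have "norm y \<le> (1 / N u) * N y" for y
  proof (cases "y = 0")
    case False
    then have "N u \<le> N ((1 / norm y) *\<^sub>R y)"
      by (intro u(2)) simp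
    then show ?thesis
      using False u0 by (simp add: N_scaleR field_simps)
  qed simp
  then show ?thesis
    using that[of "1 / N u"] u0 by simp
qed

lemma tendsto_if_N_tendsto:
  assumes "((\<lambda>u. N (f u - l)) \<longlongrightarrow> 0) G"
  shows "(f \<longlongrightarrow> l) G"
proof -
  obtain c where c: "0 < c" "\<And>y. norm y \<le> c * N y"
    using norm_le_N by blast
  have "((\<lambda>u. c * N (f u - l)) \<longlongrightarrow> 0) G"
    using tendsto_mult_right_zero[OF assms] .
  then have "((\<lambda>u. f u - l) \<longlongrightarrow> 0) G"
    by (rule Lim_null_comparison[rotated]) (simp add: c)
  then show ?thesis
    using LIM_zero_iff by blast
qed

lemma Cauchy_if_N_Cauchy:
  assumes "\<And>e. 0 < e \<Longrightarrow> \<exists>k0. \<forall>m\<ge>k0. \<forall>n\<ge>k0. N (X m - X n) < e"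
  shows "Cauchy X"
proof (rule CauchyI)
  fix e :: real assume "0 < e"
  obtain c where c: "0 < c" "\<And>y. norm y \<le> c * N y"
    using norm_le_N by blast
  obtain k0 where k0: "\<forall>m\<ge>k0. \<forall>n\<ge>k0. N (X m - X n) < e / c"
    using assms[of "e / c"] \<open>0 < e\<close> c(1) by auto
  have "norm (X m - X n) < e" if "m \<ge> k0" "n \<ge> k0" for m n
  proof -
    have "c * N (X m - X n) < e"
      using k0 that c(1) by (simp add: field_simps)
    then show ?thesis
      using c(2)[of "X m - X n"] by simp
  qed
  then show "\<exists>M. \<forall>m\<ge>M. \<forall>n\<ge>M. norm (X m - X n) < e"
    by blast
qed

text \<open>\<open>N\<close> is not the norm of the type, so the triangle inequality for integrals
  is taken from sums: both integrals are approximated over one tagged division that is fine for both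
  gauges.\<close>

lemma N_integral_le:
  fixes f :: "real \<Rightarrow> 'a"
  assumes f: "f integrable_on {a..b}" and g: "g integrable_on {a..b}"
    and le: "\<And>t. t \<in> {a..b} \<Longrightarrow> N (f t) \<le> g t"
  shows "N (integral {a..b} f) \<le> integral {a..b} g"
proof (rule field_le_epsilon)
  fix e :: real assume "0 < e"
  obtain C where C: "0 < C" "\<And>y. N y \<le> C * norm y"
    using N_le_norm by blast
  \<comment> \<open>The error for \<open>f\<close> is measured in \<open>norm\<close>; passing to
    \<open>N\<close> multiplies it by \<open>C\<close>, which leaves \<open>e / 2\<close>.\<close>
  have e: "0 < e / (2 * C)" "0 < e / 2"
    using \<open>0 < e\<close> C(1) by auto
  obtain \<gamma> where \<gamma>: "gauge \<gamma>"
    "\<And>\<D>. \<D> tagged_division_of cbox a b \<Longrightarrow> \<gamma> fine \<D> \<Longrightarrow>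
      norm ((\<Sum>(x, k)\<in>\<D>. measure lborel k *\<^sub>R f x) - integral {a..b} f) < e / (2 * C)"
    using integrable_integral[OF f] e(1) unfolding has_integral interval_cbox by meson
  obtain \<delta> where \<delta>: "gauge \<delta>"
    "\<And>\<D>. \<D> tagged_division_of cbox a b \<Longrightarrow> \<delta> fine \<D> \<Longrightarrow>
      norm ((\<Sum>(x, k)\<in>\<D>. measure lborel k *\<^sub>R g x) - integral {a..b} g) < e / 2"
    using integrable_integral[OF g] e(2) unfolding has_integral interval_cbox by meson
  obtain \<D> where \<D>: "\<D> tagged_division_of cbox a b" "(\<lambda>x. \<gamma> x \<inter> \<delta> x) fine \<D>"
    using fine_division_exists gauge_Int[OF \<gamma>(1) \<delta>(1)] by metis
  define Sf where "Sf = (\<Sum>(x, k)\<in>\<D>. measure lborel k *\<^sub>R f x)"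
  define Sg where "Sg = (\<Sum>(x, k)\<in>\<D>. measure lborel k *\<^sub>R g x)"
  have "N Sf \<le> (\<Sum>(x, k)\<in>\<D>. N (measure lborel k *\<^sub>R f x))"
    unfolding Sf_def using N_sum[of "\<lambda>(x, k). measure lborel k *\<^sub>R f x" \<D>]
    by (simp add: case_prod_unfold)
  also have "\<dots> \<le> Sg"
    unfolding Sg_def
  proof (rule sum_mono, clarify)
    fix x k assume "(x, k) \<in> \<D>"
    then have "x \<in> {a..b}"
      using tag_in_interval[OF \<D>(1)] by simp
    then show "N (measure lborel k *\<^sub>R f x) \<le> measure lborel k *\<^sub>R g x"
      using le by (simp add: N_scaleR mult_left_mono)
  qed
  finally have 1: "N Sf \<le> Sg" .
  have "norm (Sf - integral {a..b} f) < e / (2 * C)" "norm (Sg - integral {a..b} g) < e / 2"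
    using \<gamma>(2)[OF \<D>(1)] \<delta>(2)[OF \<D>(1)] \<D>(2) unfolding Sf_def Sg_def fine_Int by blast+
  moreover from this(1) have "C * norm (Sf - integral {a..b} f) < e / 2"
    using C(1) by (simp add: field_simps)
  moreover have "N (integral {a..b} f) \<le> N Sf + N (Sf - integral {a..b} f)"
    using N_abs_diff[of Sf "integral {a..b} f"] by linarith
  ultimately show "N (integral {a..b} f) \<le> integral {a..b} g + e"
    using 1 C(2)[of "Sf - integral {a..b} f"] by (simp add: abs_if split: if_splits)
qed

section \<open>Hausdorff distance and metric pairs\<close>

lemma bdd_below_point_dist: "bdd_below ((\<lambda>q. N (y - q)) ` B)"
  by (rule bdd_belowI2[of _ 0]) simp

lemma point_dist_le: "q \<in> B \<Longrightarrow> point_dist N y B \<le> N (y - q)"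
  unfolding point_dist_def by (rule cINF_lower[OF bdd_below_point_dist])

lemma point_dist_nonneg: "B \<noteq> {} \<Longrightarrow> 0 \<le> point_dist N y B"
  unfolding point_dist_def by (rule cINF_greatest) auto

lemma haus_le:
  assumes "A \<noteq> {}" "B \<noteq> {}"
    and "\<And>p. p \<in> A \<Longrightarrow> \<exists>q\<in>B. N (p - q) \<le> C"
    and "\<And>q. q \<in> B \<Longrightarrow> \<exists>p\<in>A. N (q - p) \<le> C"
  shows "haus N A B \<le> C"
  unfolding haus_def
proof (rule max.boundedI)
  show "(SUP p\<in>A. point_dist N p B) \<le> C"
    using assms(1,3) by (intro cSUP_least) (blast intro: order_trans[OF point_dist_le])+
  show "(SUP q\<in>B. point_dist N q A) \<le> C"
    using assms(2,4) by (intro cSUP_least) (blast intro: order_trans[OF point_dist_le])+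
qed

text \<open>The suprema in \<open>haus\<close> are real ones and dominate their terms only once
  boundedness is known. The distance to one fixed point of \<open>B\<close> is a continuous majorant
  on \<open>A\<close>.\<close>

lemma bdd_above_point_dist:
  assumes "compact A" "B \<noteq> {}"
  shows "bdd_above ((\<lambda>p. point_dist N p B) ` A)"
proof -
  obtain q where "q \<in> B"
    using assms(2) by blast
  have "continuous_on A (\<lambda>p. N (p - q))"
    by (intro continuous_on_N' continuous_on_diff continuous_on_const continuous_on_id)
  then have "bdd_above ((\<lambda>p. N (p - q)) ` A)"
    using assms(1) by (simp add: compact_continuous_image compact_imp_bounded bounded_imp_bdd_above)
  then obtain C where "\<And>p. p \<in> A \<Longrightarrow> N (p - q) \<le> C"
    unfolding bdd_above_def by auto
  then show ?thesis
    using order_trans[OF point_dist_le[OF \<open>q \<in> B\<close>]] by (intro bdd_aboveI2[where M = C]) blast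
qed

lemma point_dist_le_haus:
  assumes "compact A" "B \<noteq> {}" "p \<in> A"
  shows "point_dist N p B \<le> haus N A B" "point_dist N p B \<le> haus N B A"
  using cSUP_upper[OF assms(3) bdd_above_point_dist[OF assms(1,2)]] by (auto simp: haus_def)

lemma haus_nonneg:
  assumes "compact A" "A \<noteq> {}" "B \<noteq> {}"
  shows "0 \<le> haus N A B"
  using point_dist_le_haus(1)[OF assms(1,3)] point_dist_nonneg[OF assms(3)] assms(2)
  by (meson all_not_in_conv order_trans)

text \<open>Whichever coordinate is a nearest point to the other, the distance equals a
  \<open>point_dist\<close>, one of the terms in the suprema of \<open>haus\<close>.\<close>

lemma metric_pairs_le_haus:
  assumes "compact A" "compact B" "(p, q) \<in> metric_pairs N A B"
  shows "N (p - q) \<le> haus N A B"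
  using assms(3) point_dist_le_haus(1)[OF assms(1), of B p] point_dist_le_haus(2)[OF assms(2), of A q]
  by (auto simp: metric_pairs_def proj_set_def N_diff_commute) blast+

lemma proj_set_nonempty:
  assumes "compact B" "B \<noteq> {}"
  shows "proj_set N B y \<noteq> {}"
proof -
  have "continuous_on B (\<lambda>q. N (y - q))"
    by (intro continuous_on_N' continuous_on_diff continuous_on_const continuous_on_id)
  then obtain q where q: "q \<in> B" "\<And>q'. q' \<in> B \<Longrightarrow> N (y - q) \<le> N (y - q')"
    using continuous_attains_inf[OF assms] by metis
  then have "N (y - q) = point_dist N y B"
    unfolding point_dist_def using assms(2)
    by (intro antisym cINF_greatest cINF_lower bdd_below_point_dist)
  then show ?thesis
    using q(1) by (auto simp: proj_set_def)
qed

lemma metric_pairs_extend: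
  assumes "compact B" "B \<noteq> {}" "p \<in> A"
  shows "\<exists>q\<in>B. (p, q) \<in> metric_pairs N A B"
  using proj_set_nonempty[OF assms(1,2), of p] assms(3) by (auto simp: metric_pairs_def proj_set_def)

end

section \<open>Partitions and the cell that contains a point\<close>

lemma partition_mono:
  assumes "is_partition a b n p" "i \<le> j" "j \<le> n"
  shows "p i \<le> p j"
  using assms(2,3,1)
  by (induction j rule: dec_induct) (auto simp: is_partition_def Suc_le_eq intro: order.trans[OF _ less_imp_le])

lemma partition_in:
  assumes "is_partition a b n p" "i \<le> n"
  shows "p i \<in> {a..b}"
  using partition_mono[OF assms(1), of 0 i] partition_mono[OF assms(1), of i n] assms
  by (auto simp: is_partition_def)

lemma partition_step_le_mesh: "i < n \<Longrightarrow> p (Suc i) - p i \<le> mesh n p"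
  unfolding mesh_def by (rule Max_ge) auto

lemma partition_size_pos: "is_partition a b n p \<Longrightarrow> a < b \<Longrightarrow> 0 < n"
  by (cases n) (auto simp: is_partition_def)

lemma mesh_nonneg:
  assumes "is_partition a b n p" "a < b"
  shows "0 \<le> mesh n p"
  using partition_step_le_mesh[of 0 n p] partition_size_pos[OF assms] assms(1)
  by (force simp: is_partition_def)

lemma fine_partitions_exist:
  assumes "a < b"
  obtains n p where "\<And>k. is_partition a b (n k) (p k)" "(\<lambda>k. mesh (n k) (p k)) \<longlonglongrightarrow> 0"
proof
  define p where "p k i = a + (b - a) * real i / real (Suc k)" for k i
  have step: "p k (Suc i) - p k i = (b - a) / real (Suc k)" for k i
    by (simp add: p_def distrib_left add_divide_distrib)
  then have lt: "p k i < p k (Suc i)" for k i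
    using assms by (metis diff_gt_0_iff_gt divide_pos_pos of_nat_0_less_iff zero_less_Suc)
  have ends: "p k 0 = a" "p k (Suc k) = b" for k
    using nonzero_mult_div_cancel_right[of "real (Suc k)" "b - a"] by (simp_all add: p_def del: of_nat_Suc)
  show "is_partition a b (Suc k) (p k)" for k
    using lt ends by (simp add: is_partition_def)
  have "mesh (Suc k) (p k) = (b - a) / real (Suc k)" for k
    unfolding mesh_def step by (auto simp: image_constant_conv)
  then show "(\<lambda>k. mesh (Suc k) (p k)) \<longlonglongrightarrow> 0"
    using LIMSEQ_Suc[OF lim_const_over_n[of "b - a"]] by simp
qed

text \<open>The index that \<open>chain_fun\<close> selects, separated from the chain: its
  monotonicity and the distance of its node from \<open>t\<close> depend on the partition
  alone.\<close>

definition partition_index :: "nat \<Rightarrow> (nat \<Rightarrow> real) \<Rightarrow> real \<Rightarrow> nat" where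
  "partition_index n p t = (if t = p n then n else THE i. i < n \<and> p i \<le> t \<and> t < p (Suc i))"

lemma chain_fun_index: "chain_fun n p y t = y (partition_index n p t)"
  by (simp add: chain_fun_def partition_index_def)

lemma partition_index_eq:
  assumes p: "is_partition a b n p" and i: "i < n" "p i \<le> t" "t < p (Suc i)"
  shows "partition_index n p t = i"
proof -
  have "t \<noteq> p n"
    using partition_mono[OF p, of "Suc i" n] i by auto
  moreover have "(THE i. i < n \<and> p i \<le> t \<and> t < p (Suc i)) = i"
  proof (rule the_equality)
    fix j assume j: "j < n \<and> p j \<le> t \<and> t < p (Suc j)"
    have "\<not> j < i" "\<not> i < j"
      using partition_mono[OF p, of "Suc j" i] partition_mono[OF p, of "Suc i" j] i j by auto
    then show "j = i" by simp
  qed (use i in auto)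
  ultimately show ?thesis
    by (simp add: partition_index_def)
qed

lemma partition_index_cases:
  assumes p: "is_partition a b n p" and t: "t \<in> {a..b}"
  obtains "t = p n" "partition_index n p t = n"
  | "partition_index n p t < n" "p (partition_index n p t) \<le> t" "t < p (Suc (partition_index n p t))"
proof (cases "t = p n")
  case True
  then show ?thesis
    using that(1) by (simp add: partition_index_def)
next
  case False
  then have "t < p n"
    using p t by (auto simp: is_partition_def)
  \<comment> \<open>The first node beyond \<open>t\<close> is the right end of its cell. It is not
    node 0, since \<open>p 0 = a \<le> t\<close>.\<close>
  define j where "j = (LEAST j. t < p j)"
  have j: "t < p j" "j \<le> n"
    unfolding j_def using \<open>t < p n\<close> by (auto intro: LeastI Least_le)
  then obtain i where i: "j = Suc i"
    using p t by (cases j) (auto simp: is_partition_def)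
  then have "p i \<le> t"
    using not_less_Least[of i "\<lambda>j. t < p j"] j_def by auto
  then show ?thesis
    using that(2) partition_index_eq[OF p, of i t] i j by auto
qed

lemma partition_index_le: "is_partition a b n p \<Longrightarrow> t \<in> {a..b} \<Longrightarrow> partition_index n p t \<le> n"
  by (erule (1) partition_index_cases) auto

lemma partition_index_lower: "is_partition a b n p \<Longrightarrow> t \<in> {a..b} \<Longrightarrow> p (partition_index n p t) \<le> t"
  by (erule (1) partition_index_cases) auto

lemma partition_index_close:
  assumes "is_partition a b n p" "t \<in> {a..b}" "a < b"
  shows "t - mesh n p \<le> p (partition_index n p t)"
  using assms(1,2)
proof (cases rule: partition_index_cases)
  case 1
  then show ?thesis using mesh_nonneg[OF assms(1,3)] by simp
next
  case 2
  then show ?thesis using partition_step_le_mesh[of "partition_index n p t" n p] by simp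
qed

lemma partition_index_mono:
  assumes p: "is_partition a b n p" and t: "t \<in> {a..b}" "t' \<in> {a..b}" "t \<le> t'"
  shows "partition_index n p t \<le> partition_index n p t'"
  using p t(2)
proof (cases rule: partition_index_cases)
  case 1
  then show ?thesis using partition_index_le[OF p t(1)] by simp
next
  case 2
  show ?thesis
  proof (rule ccontr)
    assume "\<not> ?thesis"
    then have "p (Suc (partition_index n p t')) \<le> p (partition_index n p t)"
      using partition_index_le[OF p t(1)] by (intro partition_mono[OF p]) auto
    then show False
      using 2 partition_index_lower[OF p t(1)] t(3) by auto
  qed
qed

section \<open>Variation for a general distance function, serving both \<open>F\<close> and the
  kernels\<close>

lemma variation_sums_extend:
  assumes "S \<in> variation_sums D a t f" "t < t'"
  shows "S + D (f t') (f t) \<in> variation_sums D a t' f"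
proof -
  obtain n p where p: "is_partition a t n p" and S: "S = (\<Sum>i<n. D (f (p (Suc i))) (f (p i)))"
    using assms(1) by (auto simp: variation_sums_def)
  let ?p = "p(Suc n := t')"
  have "is_partition a t' (Suc n) ?p"
    using p assms(2) by (auto simp: is_partition_def less_Suc_eq)
  moreover have "S + D (f t') (f t) = (\<Sum>i<Suc n. D (f (?p (Suc i))) (f (?p i)))"
    using p S by (auto simp: is_partition_def)
  ultimately show ?thesis
    unfolding variation_sums_def by blast
qed

lemma variation_sums_nonempty:
  assumes "a \<le> t"
  shows "variation_sums D a t f \<noteq> {}"
proof (cases "a = t")
  case True
  then have "is_partition a t 0 (\<lambda>_. a)"
    by (simp add: is_partition_def)
  then show ?thesis
    unfolding variation_sums_def by blast
next
  case False
  then have "is_partition a t 1 (\<lambda>i. if i = 0 then a else t)"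
    using assms by (simp add: is_partition_def)
  then show ?thesis
    unfolding variation_sums_def by blast
qed

context
  fixes D :: "'c \<Rightarrow> 'c \<Rightarrow> real" and a b :: real and f :: "real \<Rightarrow> 'c"
  assumes bv: "bounded_variation D a b f"
    and nonneg: "\<And>u v. u \<in> {a..b} \<Longrightarrow> v \<in> {a..b} \<Longrightarrow> 0 \<le> D (f u) (f v)"
begin

text \<open>Appending the node \<open>b\<close> turns a sum over [a, t] into one over [a, b] and
  adds a nonnegative term.\<close>

lemma bdd_above_variation_sums:
  assumes "a \<le> t" "t \<le> b"
  shows "bdd_above (variation_sums D a t f)"
proof (cases "t = b")
  case True
  then show ?thesis using bv by (simp add: bounded_variation_def)
next
  case False
  obtain C where C: "\<And>S. S \<in> variation_sums D a b f \<Longrightarrow> S \<le> C"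
    using bv by (auto simp: bounded_variation_def bdd_above_def)
  show ?thesis
  proof (rule bdd_aboveI)
    fix S assume "S \<in> variation_sums D a t f"
    then have "S + D (f b) (f t) \<le> C"
      using False assms by (intro C variation_sums_extend) auto
    then show "S \<le> C"
      using nonneg[of b t] assms by auto
  qed
qed

text \<open>Appending \<open>t'\<close> to a partition of [a, t] adds exactly the term
  \<open>D (f t') (f t)\<close>; then the supremum is taken over the partitions of [a, t].\<close>

lemma variation_increment:
  assumes "a \<le> t" "t < t'" "t' \<le> b"
  shows "D (f t') (f t) \<le> variation D a t' f - variation D a t f"
proof -
  have "S \<le> variation D a t' f - D (f t') (f t)" if "S \<in> variation_sums D a t f" for S
    using cSup_upper[OF variation_sums_extend[OF that assms(2)] bdd_above_variation_sums] assms
    by (simp add: variation_def algebra_simps)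
  then have "variation D a t f \<le> variation D a t' f - D (f t') (f t)"
    unfolding variation_def[of D a t] using assms by (intro cSup_least variation_sums_nonempty) auto
  then show ?thesis by simp
qed

lemma mono_on_variation: "mono_on {a..b} (\<lambda>t. variation D a t f)"
proof (rule mono_onI)
  fix t t' assume "t \<in> {a..b}" "t' \<in> {a..b}" "t \<le> t'"
  then show "variation D a t f \<le> variation D a t' f"
    using variation_increment[of t t'] nonneg[of t' t] by (cases "t = t'") auto
qed

end

text \<open>Jordan decomposition: the hypothesis makes \<open>v - f\<close> monotone, so
  \<open>f\<close> is a difference of two monotone functions.\<close>

lemma integrable_if_increment_le:
  fixes f v :: "real \<Rightarrow> real"
  assumes "mono_on {a..b} v"
    and le: "\<And>t t'. a \<le> t \<Longrightarrow> t \<le> t' \<Longrightarrow> t' \<le> b \<Longrightarrow> \<bar>f t' - f t\<bar> \<le> v t' - v t"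
  shows "f integrable_on {a..b}"
proof -
  have "mono_on {a..b} (\<lambda>t. v t - f t)"
  proof (rule mono_onI)
    fix t t' assume "t \<in> {a..b}" "t' \<in> {a..b}" "t \<le> t'"
    then show "v t - f t \<le> v t' - f t'"
      using le[of t t'] by auto
  qed
  then have "(\<lambda>t. v t - (v t - f t)) integrable_on {a..b}"
    by (intro integrable_diff integrable_on_mono_on assms)
  then show ?thesis by simp
qed

section \<open>Metric chains and chain functions, controlled by the variation function\<close>

context norm_on
begin

lemma haus_commute: "haus N A B = haus N B A"
  by (simp add: haus_def max.commute)

text \<open>A chain is prolonged by choosing a nearest point in each further set. This creates
  chains from a single point, and it supplies the last node that chains in
  \<open>weighted_sums\<close> omit.\<close>

lemma metric_chain_extend:
  assumes "metric_chain N m A y" "m \<le> n"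
    and A: "\<And>i. i \<le> n \<Longrightarrow> compact (A i) \<and> A i \<noteq> {}"
  obtains y' where "metric_chain N n A y'" "\<And>i. i \<le> m \<Longrightarrow> y' i = y i"
proof -
  have "\<exists>y'. metric_chain N n A y' \<and> (\<forall>i\<le>m. y' i = y i)"
    using \<open>m \<le> n\<close> A
  proof (induction n rule: dec_induct)
    case base
    then show ?case using assms(1) by blast
  next
    case (step n)
    then obtain y' where y': "metric_chain N n A y'" "\<forall>i\<le>m. y' i = y i"
      by (meson le_SucI)
    obtain q where q: "q \<in> A (Suc n)" "(y' n, q) \<in> metric_pairs N (A n) (A (Suc n))"
      using metric_pairs_extend[of "A (Suc n)" "y' n" "A n"] step.prems y'(1)
      by (auto simp: metric_chain_def)
    have "metric_chain N (Suc n) A (y'(Suc n := q))"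
      using y'(1) q by (auto simp: metric_chain_def le_Suc_eq less_Suc_eq)
    moreover have "\<forall>i\<le>m. (y'(Suc n := q)) i = y i"
      using y'(2) step.hyps by auto
    ultimately show ?case by blast
  qed
  then show ?thesis using that by blast
qed

end

locale set_bv = norm_on N for N :: "'a::euclidean_space \<Rightarrow> real" +
  fixes a b :: real and F :: "real \<Rightarrow> 'a set"
  assumes a_less_b: "a < b" and F_in_class: "F \<in> class_F N a b"
begin

abbreviation "v \<equiv> var_fun N a F"
abbreviation "B \<equiv> sup_norm N a b F"

lemma compact_F: "t \<in> {a..b} \<Longrightarrow> compact (F t)"
  and F_nonempty: "t \<in> {a..b} \<Longrightarrow> F t \<noteq> {}"
  and compact_graph: "compact {(t, y). t \<in> {a..b} \<and> y \<in> F t}"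
  and bounded_variation_F: "bounded_variation (haus N) a b F"
  using F_in_class by (auto simp: class_F_def)

lemma haus_F_nonneg: "t \<in> {a..b} \<Longrightarrow> t' \<in> {a..b} \<Longrightarrow> 0 \<le> haus N (F t) (F t')"
  by (intro haus_nonneg compact_F F_nonempty)

lemma v_mono: "t \<in> {a..b} \<Longrightarrow> t' \<in> {a..b} \<Longrightarrow> t \<le> t' \<Longrightarrow> v t \<le> v t'"
  unfolding var_fun_def
  by (rule mono_onD[OF mono_on_variation[OF bounded_variation_F haus_F_nonneg]])

lemma metric_pairs_le_v:
  assumes "(p, q) \<in> metric_pairs N (F t) (F t')" "a \<le> t" "t < t'" "t' \<le> b"
  shows "N (q - p) \<le> v t' - v t"
proof -
  have "N (q - p) \<le> haus N (F t') (F t)"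
    using metric_pairs_le_haus[OF _ _ assms(1)] compact_F assms
    by (simp add: N_diff_commute[of q] haus_commute[of "F t'"])
  also have "\<dots> \<le> v t' - v t"
    unfolding var_fun_def using assms(2-)
    by (intro variation_increment[OF bounded_variation_F haus_F_nonneg])
  finally show ?thesis .
qed

text \<open>\<open>sup_norm\<close> is a real supremum, so a common bound is needed first; it exists
  because the projection of the compact graph to the values is compact.\<close>

lemma N_le_sup_norm:
  assumes "t \<in> {a..b}" "y \<in> F t"
  shows "N y \<le> B"
proof -
  have "compact (N ` snd ` {(t, y). t \<in> {a..b} \<and> y \<in> F t})"
    by (intro compact_continuous_image continuous_on_N continuous_on_snd continuous_on_id compact_graph)
  then have "bdd_above (N ` snd ` {(t, y). t \<in> {a..b} \<and> y \<in> F t})"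
    by (intro bounded_imp_bdd_above compact_imp_bounded)
  then obtain C where C: "\<And>t y. t \<in> {a..b} \<Longrightarrow> y \<in> F t \<Longrightarrow> N y \<le> C"
    unfolding bdd_above_def by fastforce
  have "haus N (F t) {0} \<le> C" if "t \<in> {a..b}" for t
    using C[OF that] F_nonempty[OF that] by (intro haus_le) auto
  then have bdd: "bdd_above ((\<lambda>t. haus N (F t) {0}) ` {a..b})"
    by (intro bdd_aboveI2)
  have "N y = point_dist N y {0}"
    by (simp add: point_dist_def)
  also have "\<dots> \<le> haus N (F t) {0}"
    using assms compact_F by (intro point_dist_le_haus) auto
  also have "\<dots> \<le> B"
    unfolding sup_norm_def using assms(1) bdd by (rule cSUP_upper)
  finally show ?thesis .
qed

lemma sup_norm_nonneg: "0 \<le> B"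
proof -
  obtain y where "y \<in> F a"
    using F_nonempty[of a] a_less_b by auto
  then have "N y \<le> B"
    using a_less_b by (intro N_le_sup_norm[of a]) auto
  then show ?thesis
    using N_nonneg[of y] by linarith
qed

lemma chain_le_v:
  assumes p: "is_partition a b n p" and y: "metric_chain N n (\<lambda>i. F (p i)) y"
    and "i \<le> j" "j \<le> n"
  shows "N (y j - y i) \<le> v (p j) - v (p i)"
  using assms(3,4)
proof (induction j rule: dec_induct)
  case (step j)
  have "N (y (Suc j) - y j) \<le> v (p (Suc j)) - v (p j)"
    using y step p partition_in[OF p, of j] partition_in[OF p, of "Suc j"]
    by (intro metric_pairs_le_v) (auto simp: metric_chain_def is_partition_def)
  then show ?case
    using step N_diff_triangle[of "y (Suc j)" "y i" "y j"] by auto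
qed simp

text \<open>The two values are chain entries at nodes \<open>p j \<le> t\<close> and
  \<open>p i \<ge> t' - mesh n p\<close>, and \<open>v\<close> is monotone. The \<open>max\<close>
  keeps the argument in [a, b]: below \<open>a\<close> there are no partitions, and \<open>v\<close>
  would be a supremum of the empty set.\<close>

lemma chain_fun_le_v:
  assumes p: "is_partition a b n p" and y: "metric_chain N n (\<lambda>i. F (p i)) y"
    and t: "t \<in> {a..b}" "t' \<in> {a..b}" "t' \<le> t"
  shows "N (chain_fun n p y t - chain_fun n p y t') \<le> v t - v (max a (t' - mesh n p))"
proof -
  define j i where "j = partition_index n p t" and "i = partition_index n p t'"
  have ij: "i \<le> j" "j \<le> n" "p j \<le> t" "p i \<le> t'" "t' - mesh n p \<le> p i"
    using partition_index_mono[OF p t(2,1,3)] partition_index_le[OF p t(1)]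
      partition_index_lower[OF p] partition_index_close[OF p t(2) a_less_b] t
    by (auto simp: i_def j_def)
  have in_ab: "p i \<in> {a..b}" "p j \<in> {a..b}" "max a (t' - mesh n p) \<in> {a..b}"
    using partition_in[OF p] ij t mesh_nonneg[OF p a_less_b] by auto
  have "N (y j - y i) \<le> v (p j) - v (p i)"
    by (rule chain_le_v[OF p y ij(1,2)])
  also have "\<dots> \<le> v t - v (max a (t' - mesh n p))"
    using ij in_ab t by (intro diff_mono v_mono) auto
  finally show ?thesis
    by (simp add: chain_fun_index i_def j_def)
qed

lemma chain_fun_in:
  assumes "is_partition a b n p" "metric_chain N n (\<lambda>i. F (p i)) y" "t \<in> {a..b}"
  shows "chain_fun n p y t \<in> F (p (partition_index n p t))"
  using partition_index_le[OF assms(1,3)] assms(2)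
  by (auto simp: chain_fun_index metric_chain_def)

lemma N_chain_fun_le:
  assumes "is_partition a b n p" "metric_chain N n (\<lambda>i. F (p i)) y" "t \<in> {a..b}"
  shows "N (chain_fun n p y t) \<le> B"
  using chain_fun_in[OF assms] partition_in[OF assms(1) partition_index_le[OF assms(1,3)]]
  by (rule N_le_sup_norm[rotated])

end

section \<open>Sequences of chain functions and Helly's selection principle\<close>

locale chain_seq = set_bv N a b F for N :: "'a::euclidean_space \<Rightarrow> real" and a b F +
  fixes n :: "nat \<Rightarrow> nat" and p :: "nat \<Rightarrow> nat \<Rightarrow> real" and y :: "nat \<Rightarrow> nat \<Rightarrow> 'a"
  assumes partition: "\<And>k. is_partition a b (n k) (p k)"
    and chain: "\<And>k. metric_chain N (n k) (\<lambda>i. F (p k i)) (y k)"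
    and mesh_tendsto: "(\<lambda>k. mesh (n k) (p k)) \<longlonglongrightarrow> 0"
begin

definition c :: "nat \<Rightarrow> real \<Rightarrow> 'a" where
  "c k = chain_fun (n k) (p k) (y k)"

text \<open>The chain value at \<open>t\<close> belongs to \<open>F\<close> at the node
  \<open>\<tau> k\<close>, which lies within one mesh below \<open>t\<close>. The pairs therefore
  converge inside the closed graph.\<close>

lemma limit_in_F:
  assumes t: "t \<in> {a..b}" and lim: "(\<lambda>k. c k t) \<longlonglongrightarrow> l"
  shows "l \<in> F t"
proof -
  define \<tau> where "\<tau> k = p k (partition_index (n k) (p k) t)" for k
  have "\<tau> \<longlonglongrightarrow> t"
  proof (rule real_tendsto_sandwich)
    show "\<forall>\<^sub>F k in sequentially. t - mesh (n k) (p k) \<le> \<tau> k"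
      using partition_index_close[OF partition t a_less_b] by (simp add: \<tau>_def)
    show "\<forall>\<^sub>F k in sequentially. \<tau> k \<le> t"
      using partition_index_lower[OF partition t] by (simp add: \<tau>_def)
    show "(\<lambda>k. t - mesh (n k) (p k)) \<longlonglongrightarrow> t"
      using tendsto_diff[OF tendsto_const mesh_tendsto, of t] by simp
  qed simp
  then have "(\<lambda>k. (\<tau> k, c k t)) \<longlonglongrightarrow> (t, l)"
    using lim by (intro tendsto_Pair)
  moreover have "(\<tau> k, c k t) \<in> {(t, y). t \<in> {a..b} \<and> y \<in> F t}" for k
    using chain_fun_in[OF partition chain t, of k]
      partition_in[OF partition partition_index_le[OF partition t], of k]
    by (simp add: \<tau>_def c_def)
  ultimately have "(t, l) \<in> {(t, y). t \<in> {a..b} \<and> y \<in> F t}"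
    by (rule closed_sequentially[OF compact_imp_closed[OF compact_graph], rotated])
  then show ?thesis by simp
qed

lemma limit_selection:
  assumes "\<And>t. t \<in> {a..b} \<Longrightarrow> (\<lambda>k. c k t) \<longlonglongrightarrow> s t"
  shows "s \<in> metric_selections N a b F"
proof -
  have "\<forall>t\<in>{a..b}. s t \<in> F t"
    using limit_in_F assms by blast
  moreover have "(\<forall>k. is_partition a b (n k) (p k) \<and> metric_chain N (n k) (\<lambda>i. F (p k i)) (y k)) \<and>
      (\<lambda>k. mesh (n k) (p k)) \<longlonglongrightarrow> 0 \<and>
      (\<forall>t\<in>{a..b}. (\<lambda>k. chain_fun (n k) (p k) (y k) t) \<longlonglongrightarrow> s t)"
    using partition chain mesh_tendsto assms by (simp add: c_def)
  ultimately show ?thesis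
    unfolding metric_selections_def by blast
qed

text \<open>
  Helly's selection principle, with the variation function of \<open>F\<close> as a common majorant: it is enough
  to have convergence on a countable dense set that contains the discontinuities of the majorant.
\<close>

lemma convergent_everywhere:
  assumes D: "\<And>t. t \<in> \<rat> \<inter> {a..b} \<Longrightarrow> convergent (\<lambda>k. c k t)"
    and t: "t \<in> {a<..b}" and cont: "continuous (at t within {a..b}) v"
  shows "convergent (\<lambda>k. c k t)"
proof (rule Cauchy_convergent[OF Cauchy_if_N_Cauchy])
  fix e :: real assume "0 < e"
  then have e4: "0 < e / 4" by simp
  obtain d where d: "0 < d" "\<And>u. u \<in> {a..b} \<Longrightarrow> \<bar>u - t\<bar> < d \<Longrightarrow> \<bar>v u - v t\<bar> < e / 4"
    using cont e4 unfolding continuous_within_eps_delta dist_real_def by meson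
  \<comment> \<open>The rational \<open>q\<close> uses up only half of \<open>d\<close>; the other
    half is reserved for the mesh, so that the shifted point \<open>q - mesh (n k) (p k)\<close> is
    still within \<open>d\<close> of \<open>t\<close>.\<close>
  obtain q where q: "q \<in> \<rat>" "max a (t - d / 2) < q" "q < t"
    using Rats_dense_in_real[of "max a (t - d / 2)" t] d(1) t by auto
  have q_in: "q \<in> {a..b}" and t_in: "t \<in> {a..b}"
    using q t by auto
  obtain l where l: "(\<lambda>k. c k q) \<longlonglongrightarrow> l"
    using D q(1) q_in by (auto simp: convergent_def)
  have "(\<lambda>k. N (c k q - l)) \<longlonglongrightarrow> 0"
    using tendsto_N[OF LIM_zero[OF l]] by simp
  then have "\<forall>\<^sub>F k in sequentially. N (c k q - l) < e / 4"
    using e4 by (rule order_tendstoD)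
  moreover have "\<forall>\<^sub>F k in sequentially. mesh (n k) (p k) < d / 2"
    using mesh_tendsto d(1) by (intro order_tendstoD) auto
  \<comment> \<open>Here \<open>l\<close> is the limit at \<open>q\<close>, not at \<open>t\<close>:
    it serves as a common reference point that makes the values at \<open>t\<close> a Cauchy
    sequence.\<close>
  ultimately have "\<forall>\<^sub>F k in sequentially. N (c k t - l) < e / 2"
  proof eventually_elim
    case (elim k)
    have "\<bar>v (max a (q - mesh (n k) (p k))) - v t\<bar> < e / 4"
      using elim q t mesh_nonneg[OF partition a_less_b, of k] d(1) by (intro d(2)) auto
    then have "N (c k t - c k q) < e / 4"
      using chain_fun_le_v[OF partition chain t_in q_in less_imp_le[OF q(3)], of k]
      unfolding c_def abs_less_iff by linarith
    then show ?case
      using N_diff_triangle[of "c k t" l "c k q"] elim by auto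
  qed
  then obtain k0 where k0: "\<And>k. k \<ge> k0 \<Longrightarrow> N (c k t - l) < e / 2"
    by (auto simp: eventually_sequentially)
  have "N (c i t - c j t) < e" if "i \<ge> k0" "j \<ge> k0" for i j
    using k0[OF that(1)] k0[OF that(2)] N_diff_triangle[of "c i t" "c j t" l] N_diff_commute[of l "c j t"]
    by simp
  then show "\<exists>k0. \<forall>i\<ge>k0. \<forall>j\<ge>k0. N (c i t - c j t) < e"
    by blast
qed

lemma chain_seq_subseq:
  assumes "strict_mono r"
  shows "chain_seq N a b F (n \<circ> r) (p \<circ> r) (y \<circ> r)"
  using partition chain LIMSEQ_subseq_LIMSEQ[OF mesh_tendsto assms]
  by unfold_locales (auto simp: o_def)

lemma selection_subsequence:
  obtains r s where "strict_mono r" "s \<in> metric_selections N a b F"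
    "\<And>t. t \<in> {a..b} \<Longrightarrow> (\<lambda>k. c (r k) t) \<longlonglongrightarrow> s t"
proof -
  \<comment> \<open>The left endpoint is added because \<open>convergent_everywhere\<close> needs a
    rational of the interval to the left of its point.\<close>
  define D where "D = {t \<in> {a..b}. \<not> continuous (at t within {a..b}) v} \<union> insert a (\<rat> \<inter> {a..b})"
  have "countable D"
    unfolding D_def using v_mono
    by (intro countable_Un countable_insert countable_Int1 countable_rat mono_on_ctble_discont mono_onI)
  obtain C where C: "0 < C" "\<And>u. norm u \<le> C * N u"
    using norm_le_N by blast
  have "norm (c k t) \<le> C * B" if "t \<in> D" for k t
  proof -
    have "t \<in> {a..b}"
      using that a_less_b by (auto simp: D_def)
    then have "C * N (c k t) \<le> C * B"
      using N_chain_fun_le[OF partition chain] C(1) by (simp add: c_def)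
    then show ?thesis
      using C(2) order_trans by blast
  qed
  then obtain r where r: "strict_mono r" "\<And>t. t \<in> D \<Longrightarrow> \<exists>l. (\<lambda>k. c (r k) t) \<longlonglongrightarrow> l"
    using function_convergent_subsequence[OF \<open>countable D\<close>, of c] by blast
  interpret sub: chain_seq N a b F "n \<circ> r" "p \<circ> r" "y \<circ> r"
    by (rule chain_seq_subseq[OF r(1)])
  have sub_c: "sub.c k = c (r k)" for k
    by (simp add: sub.c_def c_def)
  have conv: "convergent (\<lambda>k. c (r k) t)" if "t \<in> {a..b}" for t
  proof (cases "t \<in> D")
    case True
    then show ?thesis using r(2) by (auto simp: convergent_def)
  next
    case False
    then show ?thesis
      using that sub.convergent_everywhere[of t] r(2)
      by (fastforce simp: sub_c D_def convergent_def)
  qed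
  define s where "s t = lim (\<lambda>k. c (r k) t)" for t
  have "(\<lambda>k. c (r k) t) \<longlonglongrightarrow> s t" if "t \<in> {a..b}" for t
    using conv[OF that] by (simp add: s_def convergent_LIMSEQ_iff)
  then show ?thesis
    using that r(1) sub.limit_selection[of s] by (simp add: sub_c)
qed

end

section \<open>Kernels of bounded variation: integrals and Riemann sums\<close>

context
  fixes \<kappa> :: "real \<Rightarrow> real" and a b :: real
  assumes bv: "bounded_variation dist a b \<kappa>"
begin

lemma mono_on_variation_dist: "mono_on {a..b} (\<lambda>t. variation dist a t \<kappa>)"
  by (rule mono_on_variation[OF bv]) simp

lemma variation_dist_increment:
  assumes "a \<le> t" "t \<le> t'" "t' \<le> b"
  shows "\<bar>\<kappa> t' - \<kappa> t\<bar> \<le> variation dist a t' \<kappa> - variation dist a t \<kappa>"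
  using variation_increment[OF bv, of t t'] assms by (cases "t = t'") (auto simp: dist_real_def)

lemma bounded_variation_integrable: "\<kappa> integrable_on {a..b}"
  by (rule integrable_if_increment_le[OF mono_on_variation_dist variation_dist_increment])

lemma bounded_variation_abs_integrable: "(\<lambda>t. \<bar>\<kappa> t\<bar>) integrable_on {a..b}"
  by (rule integrable_if_increment_le[OF mono_on_variation_dist])
    (rule order_trans[OF abs_triangle_ineq3 variation_dist_increment])

lemma bounded_variation_integrable_subinterval:
  "{u..w} \<subseteq> {a..b} \<Longrightarrow> \<kappa> integrable_on {u..w}"
  by (rule integrable_on_subinterval[OF bounded_variation_integrable])

end

text \<open>Cells are concatenated by induction on \<open>j\<close>; on each cell the chain function
  is constant up to the right endpoint.\<close>

lemma has_integral_chain_fun: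
  fixes y :: "nat \<Rightarrow> 'a::euclidean_space"
  assumes \<kappa>: "\<kappa> integrable_on {a..b}" and p: "is_partition a b n p" and "j \<le> n"
  shows "((\<lambda>t. \<kappa> t *\<^sub>R chain_fun n p y t) has_integral
           (\<Sum>i<j. integral {p i..p (Suc i)} \<kappa> *\<^sub>R y i)) {a..p j}"
  using \<open>j \<le> n\<close>
proof (induction j)
  case 0
  have "p 0 = a"
    using p by (simp add: is_partition_def)
  then show ?case
    using has_integral_refl(2)[of "\<lambda>t. \<kappa> t *\<^sub>R chain_fun n p y t" a] by simp
next
  case (Suc j)
  have "{p j..p (Suc j)} \<subseteq> {a..b}"
    using partition_in[OF p, of j] partition_in[OF p, of "Suc j"] Suc.prems by auto
  then have "(\<kappa> has_integral integral {p j..p (Suc j)} \<kappa>) {p j..p (Suc j)}"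
    by (intro integrable_integral integrable_on_subinterval[OF \<kappa>])
  then have "((\<lambda>t. \<kappa> t *\<^sub>R y j) has_integral integral {p j..p (Suc j)} \<kappa> *\<^sub>R y j) {p j..p (Suc j)}"
    by (rule has_integral_scaleR_left)
  then have "((\<lambda>t. \<kappa> t *\<^sub>R chain_fun n p y t) has_integral integral {p j..p (Suc j)} \<kappa> *\<^sub>R y j)
      {p j..p (Suc j)}"
  \<comment> \<open>At \<open>p (Suc j)\<close> the chain function already takes its next value; a
    single point does not affect the integral.\<close>
  proof (rule has_integral_spike_finite[rotated 2])
    show "finite {p (Suc j)}" by simp
    fix t assume "t \<in> {p j..p (Suc j)} - {p (Suc j)}"
    then have "partition_index n p t = j"
      using Suc.prems by (intro partition_index_eq[OF p]) auto
    then show "\<kappa> t *\<^sub>R chain_fun n p y t = \<kappa> t *\<^sub>R y j"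
      by (simp add: chain_fun_index)
  qed
  moreover have "a \<le> p j" "p j \<le> p (Suc j)"
    using partition_in[OF p, of j] partition_mono[OF p, of j "Suc j"] Suc.prems by auto
  ultimately show ?case
    using has_integral_combine[of a "p j" "p (Suc j)"] Suc by simp
qed

text \<open>On a cell, \<kappa> deviates from its value at the left node by at most the increment of
  its variation. Multiplied by the cell length, at most the mesh, these increments telescope. The
  bound depends on the chain only through \<open>C\<close>.\<close>

lemma weighted_sum_minus_integral:
  fixes y :: "nat \<Rightarrow> 'a::euclidean_space"
  assumes \<kappa>: "bounded_variation dist a b \<kappa>" and p: "is_partition a b n p" and "a < b"
    and C: "\<And>i. i < n \<Longrightarrow> norm (y i) \<le> C"
  shows "norm ((\<Sum>i<n. ((p (Suc i) - p i) * \<kappa> (p i)) *\<^sub>R y i)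
               - integral {a..b} (\<lambda>t. \<kappa> t *\<^sub>R chain_fun n p y t))
           \<le> C * variation dist a b \<kappa> * mesh n p"
proof -
  let ?w = "\<lambda>t. variation dist a t \<kappa>"
  have C0: "0 \<le> C"
    using C[of 0] partition_size_pos[OF p \<open>a < b\<close>] norm_ge_zero order_trans by blast
  have step: "\<bar>integral {p i..p (Suc i)} \<kappa> - (p (Suc i) - p i) * \<kappa> (p i)\<bar>
      \<le> (?w (p (Suc i)) - ?w (p i)) * mesh n p" if "i < n" for i
  proof -
    have i: "p i \<in> {a..b}" "p (Suc i) \<in> {a..b}" "p i \<le> p (Suc i)"
      using partition_in[OF p, of i] partition_in[OF p, of "Suc i"] partition_mono[OF p, of i "Suc i"] that
      by auto
    have w: "?w (p i) \<le> ?w t" "?w t \<le> ?w (p (Suc i))" if "p i \<le> t" "t \<le> p (Suc i)" for t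
      using mono_onD[OF mono_on_variation_dist[OF \<kappa>]] i that by auto
    let ?c = "measure lborel {p i..p (Suc i)}"
    have "((\<lambda>t. \<kappa> t - \<kappa> (p i)) has_integral
        integral {p i..p (Suc i)} \<kappa> - ?c *\<^sub>R \<kappa> (p i)) {p i..p (Suc i)}"
      using i by (intro has_integral_diff integrable_integral has_integral_const_real
          bounded_variation_integrable_subinterval[OF \<kappa>]) auto
    then have "norm (integral {p i..p (Suc i)} \<kappa> - ?c *\<^sub>R \<kappa> (p i)) \<le> (?w (p (Suc i)) - ?w (p i)) * ?c"
      unfolding interval_cbox
    proof (rule has_integral_bound[rotated])
      fix t assume "t \<in> cbox (p i) (p (Suc i))"
      then show "norm (\<kappa> t - \<kappa> (p i)) \<le> ?w (p (Suc i)) - ?w (p i)"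
        using variation_dist_increment[OF \<kappa>, of "p i" t] w(2)[of t] i by auto
    qed (use w(1)[of "p (Suc i)"] i in auto)
    then have "\<bar>integral {p i..p (Suc i)} \<kappa> - (p (Suc i) - p i) * \<kappa> (p i)\<bar>
        \<le> (?w (p (Suc i)) - ?w (p i)) * (p (Suc i) - p i)"
      using i by simp
    also have "\<dots> \<le> (?w (p (Suc i)) - ?w (p i)) * mesh n p"
      using w(1)[of "p (Suc i)"] i partition_step_le_mesh[OF that] by (intro mult_left_mono) auto
    finally show ?thesis .
  qed
  have pn: "p 0 = a" "p n = b"
    using p by (auto simp: is_partition_def)
  \<comment> \<open>A partition of [a, a] has no cells, so the telescoped increments give the whole
    variation of \<kappa>.\<close>
  have w_a: "?w a = 0"
  proof -
    have "variation_sums dist a a \<kappa> = {0}"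
    proof -
      have "m = 0" if "is_partition a a m q" for m q
        using partition_mono[OF that, of 1 m] that by (cases m) (auto simp: is_partition_def)
      then show ?thesis
        using variation_sums_nonempty[of a a dist \<kappa>] unfolding variation_sums_def by fastforce
    qed
    then show ?thesis by (simp add: variation_def)
  qed
  have "integral {a..b} (\<lambda>t. \<kappa> t *\<^sub>R chain_fun n p y t) = (\<Sum>i<n. integral {p i..p (Suc i)} \<kappa> *\<^sub>R y i)"
    using has_integral_chain_fun[OF bounded_variation_integrable[OF \<kappa>] p order_refl, of y] pn
    by (auto intro: integral_unique)
  then have "norm ((\<Sum>i<n. ((p (Suc i) - p i) * \<kappa> (p i)) *\<^sub>R y i)
      - integral {a..b} (\<lambda>t. \<kappa> t *\<^sub>R chain_fun n p y t))
    = norm (\<Sum>i<n. (integral {p i..p (Suc i)} \<kappa> - (p (Suc i) - p i) * \<kappa> (p i)) *\<^sub>R y i)"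
    by (simp add: norm_minus_commute sum_subtractf scaleR_left_diff_distrib)
  also have "\<dots> \<le> (\<Sum>i<n. ((?w (p (Suc i)) - ?w (p i)) * mesh n p) * C)"
    using step C mult_mono[OF step C] order_trans[OF abs_ge_zero step]
    by (intro sum_norm_le) simp
  also have "\<dots> = (?w (p n) - ?w (p 0)) * mesh n p * C"
    using sum_lessThan_telescope[of "\<lambda>i. ?w (p i)" n] by (simp add: sum_distrib_right[symmetric])
  finally show ?thesis
    by (simp add: pn w_a mult_ac)
qed

context chain_seq
begin

lemma norm_c_bounded: obtains C where "\<And>k t. t \<in> {a..b} \<Longrightarrow> norm (c k t) \<le> C"
proof -
  obtain C where C: "0 < C" "\<And>u. norm u \<le> C * N u"
    using norm_le_N by blast
  have "norm (c k t) \<le> C * B" if "t \<in> {a..b}" for k t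
    using C order_trans[OF C(2) mult_left_mono[OF N_chain_fun_le[OF partition chain that, of k], of C]]
    by (simp add: c_def)
  then show ?thesis using that by blast
qed

text \<open>The integrals of the chain functions converge by dominated convergence with majorant
  \<open>C * \<bar>\<kappa> t\<bar>\<close>; the weighted sums follow them up to a multiple of the
  mesh.\<close>

lemma
  assumes \<kappa>: "bounded_variation dist a b \<kappa>"
    and s: "\<And>t. t \<in> {a..b} \<Longrightarrow> (\<lambda>k. c k t) \<longlonglongrightarrow> s t"
  shows integrable_limit: "(\<lambda>t. \<kappa> t *\<^sub>R s t) integrable_on {a..b}"
    and weighted_sums_tendsto:
      "(\<lambda>k. \<Sum>i<n k. ((p k (Suc i) - p k i) * \<kappa> (p k i)) *\<^sub>R y k i)
        \<longlonglongrightarrow> integral {a..b} (\<lambda>t. \<kappa> t *\<^sub>R s t)"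
proof -
  obtain C where C: "\<And>k t. t \<in> {a..b} \<Longrightarrow> norm (c k t) \<le> C"
    using norm_c_bounded by blast
  have int: "(\<lambda>t. \<kappa> t *\<^sub>R c k t) integrable_on {a..b}" for k
    using has_integral_chain_fun[OF bounded_variation_integrable[OF \<kappa>] partition order_refl, of k "y k"]
      partition[of k] by (auto simp: c_def is_partition_def)
  have dom: "(\<lambda>t. C * \<bar>\<kappa> t\<bar>) integrable_on {a..b}"
    using bounded_variation_abs_integrable[OF \<kappa>] integrable_on_cmult_left by fastforce
  have le: "norm (\<kappa> t *\<^sub>R c k t) \<le> C * \<bar>\<kappa> t\<bar>" if "t \<in> {a..b}" for k t
    using mult_left_mono[OF C[OF that], of "\<bar>\<kappa> t\<bar>" k] by (simp add: mult.commute)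
  have conv: "(\<lambda>k. \<kappa> t *\<^sub>R c k t) \<longlonglongrightarrow> \<kappa> t *\<^sub>R s t" if "t \<in> {a..b}" for t
    by (intro tendsto_scaleR tendsto_const s that)
  show "(\<lambda>t. \<kappa> t *\<^sub>R s t) integrable_on {a..b}"
    by (rule dominated_convergence(1)[OF int dom le conv])
  have lim: "(\<lambda>k. integral {a..b} (\<lambda>t. \<kappa> t *\<^sub>R c k t)) \<longlonglongrightarrow> integral {a..b} (\<lambda>t. \<kappa> t *\<^sub>R s t)"
    by (rule dominated_convergence(2)[OF int dom le conv])
  \<comment> \<open>Each of these entries is the value of \<open>c k\<close> at its own node and
    inherits the uniform bound.\<close>
  have "norm (y k i) \<le> C" if "i < n k" for k i
  proof -
    have "partition_index (n k) (p k) (p k i) = i"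
      using partition[of k] that by (intro partition_index_eq[OF partition]) (auto simp: is_partition_def)
    then show ?thesis
      using C[of "p k i" k] partition_in[OF partition, of i k] that by (simp add: c_def chain_fun_index)
  qed
  then have "norm ((\<Sum>i<n k. ((p k (Suc i) - p k i) * \<kappa> (p k i)) *\<^sub>R y k i)
      - integral {a..b} (\<lambda>t. \<kappa> t *\<^sub>R c k t)) \<le> C * variation dist a b \<kappa> * mesh (n k) (p k)" for k
    unfolding c_def by (intro weighted_sum_minus_integral[OF \<kappa> partition a_less_b])
  then have "(\<lambda>k. (\<Sum>i<n k. ((p k (Suc i) - p k i) * \<kappa> (p k i)) *\<^sub>R y k i)
      - integral {a..b} (\<lambda>t. \<kappa> t *\<^sub>R c k t)) \<longlonglongrightarrow> 0"
    by (intro Lim_null_comparison[OF always_eventually tendsto_mult_right_zero[OF mesh_tendsto]] allI)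
  then show "(\<lambda>k. \<Sum>i<n k. ((p k (Suc i) - p k i) * \<kappa> (p k i)) *\<^sub>R y k i)
      \<longlonglongrightarrow> integral {a..b} (\<lambda>t. \<kappa> t *\<^sub>R s t)"
    using tendsto_add[OF _ lim] by fastforce
qed

end

section \<open>The weighted metric integral as a set of integrals of selections\<close>

context set_bv
begin

lemma metric_selectionE:
  assumes "s \<in> metric_selections N a b F"
  obtains n p y where "chain_seq N a b F n p y"
    "\<And>t. t \<in> {a..b} \<Longrightarrow> (\<lambda>k. chain_seq.c n p y k t) \<longlonglongrightarrow> s t"
proof -
  obtain n p y where npy: "\<And>k. is_partition a b (n k) (p k)" "\<And>k. metric_chain N (n k) (\<lambda>i. F (p k i)) (y k)"
    "(\<lambda>k. mesh (n k) (p k)) \<longlonglongrightarrow> 0" "\<And>t. t \<in> {a..b} \<Longrightarrow> (\<lambda>k. chain_fun (n k) (p k) (y k) t) \<longlonglongrightarrow> s t"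
    using assms unfolding metric_selections_def by blast
  interpret chain_seq N a b F n p y
    using npy by unfold_locales auto
  show ?thesis
    using that[of n p y] chain_seq_axioms npy(4) by (simp add: c_def)
qed

text \<open>A point of \<open>F a\<close> prolongs to a chain on each of a sequence of ever finer
  partitions, and a subsequence converges to a selection. Without this, the suprema in
  \<open>haus\<close> would range over empty sets.\<close>

lemma metric_selections_nonempty: "metric_selections N a b F \<noteq> {}"
proof -
  obtain n p where np: "\<And>k. is_partition a b (n k) (p k)" "(\<lambda>k. mesh (n k) (p k)) \<longlonglongrightarrow> 0"
    using fine_partitions_exist[OF a_less_b] by blast
  have F: "compact (F (p k i)) \<and> F (p k i) \<noteq> {}" if "i \<le> n k" for k i
    using partition_in[OF np(1) that] compact_F F_nonempty by blast
  have "\<exists>y. metric_chain N (n k) (\<lambda>i. F (p k i)) y" for k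
  proof -
    obtain q where "q \<in> F (p k 0)"
      using F[of 0 k] by auto
    then have "metric_chain N 0 (\<lambda>i. F (p k i)) (\<lambda>_. q)"
      by (simp add: metric_chain_def)
    then show ?thesis
      by (rule metric_chain_extend[where n = "n k"]) (use F in auto)
  qed
  then obtain y where "\<And>k. metric_chain N (n k) (\<lambda>i. F (p k i)) (y k)"
    by metis
  then interpret chain_seq N a b F n p y
    using np by unfold_locales auto
  show ?thesis
    using selection_subsequence by blast
qed

text \<open>From left to right, a subsequence of the chains converges to a selection while the sums
  along it keep the limit \<open>l\<close>. Conversely, the chains that define a selection, cut
  before the last node, already furnish the sums.\<close>

lemma weighted_metric_integral_eq:
  assumes \<kappa>: "bounded_variation dist a b \<kappa>"
  shows "weighted_metric_integral N a b \<kappa> F =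
    (\<lambda>s. integral {a..b} (\<lambda>t. \<kappa> t *\<^sub>R s t)) ` metric_selections N a b F"
proof (intro subset_antisym subsetI)
  fix l assume "l \<in> weighted_metric_integral N a b \<kappa> F"
  then obtain n p z where p: "\<And>k. is_partition a b (n k) (p k)"
    and z: "\<And>k. z k \<in> weighted_sums N \<kappa> F (n k) (p k)"
    and lim: "(\<lambda>k. mesh (n k) (p k)) \<longlonglongrightarrow> 0" "z \<longlonglongrightarrow> l"
    unfolding weighted_metric_integral_def by blast
  have F: "compact (F (p k i)) \<and> F (p k i) \<noteq> {}" if "i \<le> n k" for k i
    using partition_in[OF p that] compact_F F_nonempty by blast
  have "\<exists>y. metric_chain N (n k) (\<lambda>i. F (p k i)) y \<and>
      z k = (\<Sum>i<n k. ((p k (Suc i) - p k i) * \<kappa> (p k i)) *\<^sub>R y i)" for k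
  proof -
    obtain y where y: "metric_chain N (n k - 1) (\<lambda>i. F (p k i)) y"
      "z k = (\<Sum>i<n k. ((p k (Suc i) - p k i) * \<kappa> (p k i)) *\<^sub>R y i)"
      using z[of k] unfolding weighted_sums_def by blast
    \<comment> \<open>A chain function needs an entry at the last node as well; the added entry does
      not enter the sum.\<close>
    obtain y' where y': "metric_chain N (n k) (\<lambda>i. F (p k i)) y'" "\<And>i. i \<le> n k - 1 \<Longrightarrow> y' i = y i"
      by (rule metric_chain_extend[OF y(1), of "n k"]) (use F in auto)
    have "z k = (\<Sum>i<n k. ((p k (Suc i) - p k i) * \<kappa> (p k i)) *\<^sub>R y' i)"
      unfolding y(2) using y'(2) by (intro sum.cong) auto
    then show ?thesis using y'(1) by blast
  qed
  then obtain y where y: "\<And>k. metric_chain N (n k) (\<lambda>i. F (p k i)) (y k)"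
    "\<And>k. z k = (\<Sum>i<n k. ((p k (Suc i) - p k i) * \<kappa> (p k i)) *\<^sub>R y k i)"
    by metis
  interpret chain_seq N a b F n p y
    using p y(1) lim(1) by unfold_locales auto
  obtain r s where r: "strict_mono r" and s: "s \<in> metric_selections N a b F"
    "\<And>t. t \<in> {a..b} \<Longrightarrow> (\<lambda>k. c (r k) t) \<longlonglongrightarrow> s t"
    using selection_subsequence by blast
  interpret sub: chain_seq N a b F "n \<circ> r" "p \<circ> r" "y \<circ> r"
    by (rule chain_seq_subseq[OF r])
  have sub_lim: "(\<lambda>k. sub.c k t) \<longlonglongrightarrow> s t" if "t \<in> {a..b}" for t
    using s(2)[OF that] by (simp add: sub.c_def c_def)
  have "(z \<circ> r) \<longlonglongrightarrow> integral {a..b} (\<lambda>t. \<kappa> t *\<^sub>R s t)"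
    using sub.weighted_sums_tendsto[OF \<kappa> sub_lim] by (simp add: y(2) o_def)
  moreover have "(z \<circ> r) \<longlonglongrightarrow> l"
    by (rule LIMSEQ_subseq_LIMSEQ[OF lim(2) r])
  ultimately show "l \<in> (\<lambda>s. integral {a..b} (\<lambda>t. \<kappa> t *\<^sub>R s t)) ` metric_selections N a b F"
    using s(1) LIMSEQ_unique by blast
next
  fix l assume "l \<in> (\<lambda>s. integral {a..b} (\<lambda>t. \<kappa> t *\<^sub>R s t)) ` metric_selections N a b F"
  then obtain s where s: "s \<in> metric_selections N a b F" and l: "l = integral {a..b} (\<lambda>t. \<kappa> t *\<^sub>R s t)"
    by blast
  obtain n p y where npy: "chain_seq N a b F n p y"
    and lim: "\<And>t. t \<in> {a..b} \<Longrightarrow> (\<lambda>k. chain_seq.c n p y k t) \<longlonglongrightarrow> s t"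
    using metric_selectionE[OF s] by blast
  interpret chain_seq N a b F n p y by (rule npy)
  define z where "z k = (\<Sum>i<n k. ((p k (Suc i) - p k i) * \<kappa> (p k i)) *\<^sub>R y k i)" for k
  have "metric_chain N (n k - 1) (\<lambda>i. F (p k i)) (y k)" for k
    using chain[of k] by (auto simp: metric_chain_def)
  then have "z k \<in> weighted_sums N \<kappa> F (n k) (p k)" for k
    unfolding weighted_sums_def z_def by blast
  moreover have "z \<longlonglongrightarrow> l"
    using weighted_sums_tendsto[OF \<kappa> lim] by (simp add: z_def[abs_def] l)
  ultimately show "l \<in> weighted_metric_integral N a b \<kappa> F"
    unfolding weighted_metric_integral_def using partition mesh_tendsto by blast
qed

end

section \<open>Integrals split at \<open>x\<close> and outside a neighbourhood of
  \<open>x\<close>\<close>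

lemma integrable_mult_sgn:
  fixes \<kappa> :: "real \<Rightarrow> real"
  assumes \<kappa>: "\<kappa> integrable_on {a..b}" and x: "a \<le> x" "x \<le> b"
  shows "(\<lambda>t. \<kappa> t * sgn (t - x)) integrable_on {a..b}"
proof (rule Henstock_Kurzweil_Integration.integrable_combine[OF x])
  have "(\<lambda>t. - \<kappa> t) integrable_on {a..x}"
    using integrable_on_subinterval[OF \<kappa>, of a x] x by (intro integrable_neg) auto
  then show "(\<lambda>t. \<kappa> t * sgn (t - x)) integrable_on {a..x}"
    by (rule integrable_spike_finite[of "{x}", rotated 2]) auto
  have "\<kappa> integrable_on {x..b}"
    using integrable_on_subinterval[OF \<kappa>, of x b] x by auto
  then show "(\<lambda>t. \<kappa> t * sgn (t - x)) integrable_on {x..b}"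
    by (rule integrable_spike_finite[of "{x}", rotated 2]) auto
qed

text \<open>Recasts the integral in \<open>beta\<close> as one over all of [a, b], where it can be
  added to the others.\<close>

lemma has_integral_outside_ball:
  fixes f :: "real \<Rightarrow> real"
  assumes f: "f integrable_on {a..b}" and "a < x" "x < b" "0 < \<delta>"
  shows "((\<lambda>t. if \<delta> \<le> \<bar>x - t\<bar> then f t else 0) has_integral
           integral {t \<in> {a..b}. \<bar>x - t\<bar> \<ge> \<delta>} f) {a..b}"
proof -
  \<comment> \<open>Either interval may be empty when \<delta> is large.\<close>
  have eq: "{t \<in> {a..b}. \<bar>x - t\<bar> \<ge> \<delta>} = {a..x - \<delta>} \<union> {x + \<delta>..b}"
    using assms(2-) by auto
  have "{a..x - \<delta>} \<inter> {x + \<delta>..b} = {}"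
    using assms(4) by auto
  moreover have "f integrable_on {a..x - \<delta>}" "f integrable_on {x + \<delta>..b}"
    using assms(2-) by (auto intro: integrable_on_subinterval[OF f])
  ultimately have "f integrable_on {t \<in> {a..b}. \<bar>x - t\<bar> \<ge> \<delta>}"
    unfolding eq by (intro integrable_Un) auto
  then have "((\<lambda>t. if t \<in> {t \<in> {a..b}. \<bar>x - t\<bar> \<ge> \<delta>} then f t else 0) has_integral
      integral {t \<in> {a..b}. \<bar>x - t\<bar> \<ge> \<delta>} f) {a..b}"
    by (subst has_integral_restrict) auto
  then show ?thesis
    by (rule has_integral_eq[rotated]) auto
qed

section \<open>One-sided limits of the variation function and of selections\<close>

context set_bv
begin

lemma norm_F_bounded: obtains C where "\<And>t y. t \<in> {a..b} \<Longrightarrow> y \<in> F t \<Longrightarrow> norm y \<le> C"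
proof -
  obtain C where C: "0 < C" "\<And>u. norm u \<le> C * N u"
    using norm_le_N by blast
  have "norm y \<le> C * B" if "t \<in> {a..b}" "y \<in> F t" for t y
    using order_trans[OF C(2) mult_left_mono[OF N_le_sup_norm[OF that], of C]] C(1) by simp
  then show ?thesis using that by blast
qed

lemma selection_in_F: "s \<in> metric_selections N a b F \<Longrightarrow> t \<in> {a..b} \<Longrightarrow> s t \<in> F t"
  by (simp add: metric_selections_def)

text \<open>Limit of \<open>chain_fun_le_v\<close>: eventually the mesh is below \<epsilon>, and
  \<epsilon> then replaces it by monotonicity of \<open>v\<close>.\<close>

lemma selection_le_v:
  assumes s: "s \<in> metric_selections N a b F"
    and t: "t \<in> {a..b}" "t' \<in> {a..b}" "t' \<le> t" and "0 < \<epsilon>"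
  shows "N (s t - s t') \<le> v t - v (max a (t' - \<epsilon>))"
proof -
  obtain n p y where npy: "chain_seq N a b F n p y"
    and lim: "\<And>t. t \<in> {a..b} \<Longrightarrow> (\<lambda>k. chain_seq.c n p y k t) \<longlonglongrightarrow> s t"
    using metric_selectionE[OF s] by blast
  interpret chain_seq N a b F n p y by (rule npy)
  have "\<forall>\<^sub>F k in sequentially. mesh (n k) (p k) < \<epsilon>"
    using mesh_tendsto \<open>0 < \<epsilon>\<close> by (rule order_tendstoD)
  then have "\<forall>\<^sub>F k in sequentially. N (c k t - c k t') \<le> v t - v (max a (t' - \<epsilon>))"
  proof eventually_elim
    case (elim k)
    have "v (max a (t' - \<epsilon>)) \<le> v (max a (t' - mesh (n k) (p k)))"
      using elim t mesh_nonneg[OF partition a_less_b, of k] by (intro v_mono) auto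
    then show ?case
      using chain_fun_le_v[OF partition chain t, of k] by (simp add: c_def)
  qed
  moreover have "(\<lambda>k. N (c k t - c k t')) \<longlonglongrightarrow> N (s t - s t')"
    by (intro tendsto_N tendsto_diff lim t)
  ultimately show ?thesis
    by (intro tendsto_upperbound) auto
qed

text \<open>A filter version that serves both sides. The values of \<open>s\<close> lie eventually
  in a ball and cluster at some \<open>l\<close>; non-strict inequalities between continuous
  functions pass to cluster points, so \<open>h\<close> bounds the distance to \<open>l\<close> and
  forces convergence.\<close>

lemma one_sided_limit:
  assumes s: "s \<in> metric_selections N a b F" and "G \<noteq> bot"
    and T: "\<forall>\<^sub>F t in G. t \<in> T" "T \<subseteq> {a..b}"
    and h: "(h \<longlongrightarrow> 0) G" "\<And>t. t \<in> T \<Longrightarrow> \<forall>\<^sub>F u in G. N (s t - s u) \<le> h t"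
  obtains l where "(s \<longlongrightarrow> l) G" "\<And>t. t \<in> T \<Longrightarrow> N (s t - l) \<le> h t" "N l \<le> B"
proof -
  obtain C where C: "\<And>t y. t \<in> {a..b} \<Longrightarrow> y \<in> F t \<Longrightarrow> norm y \<le> C"
    using norm_F_bounded by blast
  have ev: "\<forall>\<^sub>F u in G. u \<in> {a..b}"
    by (rule eventually_mono[OF T(1)]) (use T(2) in auto)
  have "\<forall>\<^sub>F u in G. s u \<in> cball 0 C"
    using ev by eventually_elim (use C selection_in_F[OF s] in auto)
  then have "\<forall>\<^sub>F y in filtermap s G. y \<in> cball 0 C"
    by (simp add: eventually_filtermap)
  moreover have "filtermap s G \<noteq> bot"
    using \<open>G \<noteq> bot\<close> by (simp add: filtermap_bot_iff)
  ultimately obtain l where l: "inf (nhds l) (filtermap s G) \<noteq> bot"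
    using compact_cball[of 0 C] unfolding compact_filter by blast
  have cluster: "f l \<le> e" if "\<forall>\<^sub>F u in G. f (s u) \<le> e" "continuous_on UNIV f"
    for f :: "'a \<Rightarrow> real" and e
  proof (rule ccontr)
    assume "\<not> f l \<le> e"
    moreover have "open {y. e < f y}"
      using that(2) by (intro open_Collect_less continuous_on_const)
    ultimately have "\<forall>\<^sub>F y in nhds l. e < f y"
      unfolding eventually_nhds by (intro exI[of _ "{y. e < f y}"]) auto
    moreover have "\<forall>\<^sub>F y in filtermap s G. f y \<le> e"
      using that(1) by (simp add: eventually_filtermap)
    ultimately have "\<forall>\<^sub>F y in inf (nhds l) (filtermap s G). False"
      unfolding eventually_inf by (intro exI[of _ "\<lambda>y. e < f y"] exI[of _ "\<lambda>y. f y \<le> e"]) auto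
    then show False
      using l by (simp add: trivial_limit_def)
  qed
  have le: "N (s t - l) \<le> h t" if "t \<in> T" for t
    by (rule cluster[OF h(2)[OF that]])
      (intro continuous_on_N' continuous_on_diff continuous_on_const continuous_on_id)
  have "\<forall>\<^sub>F t in G. norm (N (s t - l)) \<le> h t"
    using T(1) by eventually_elim (simp add: le)
  then have "((\<lambda>t. N (s t - l)) \<longlongrightarrow> 0) G"
    using h(1) by (rule Lim_null_comparison)
  then have "(s \<longlongrightarrow> l) G"
    by (rule tendsto_if_N_tendsto)
  moreover have "N l \<le> B"
  proof (rule cluster[OF _ continuous_on_N])
    show "\<forall>\<^sub>F u in G. N (s u) \<le> B"
      using ev by eventually_elim (blast intro: N_le_sup_norm selection_in_F[OF s])
  qed
  ultimately show ?thesis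
    using that le by blast
qed

context
  fixes x :: real
  assumes x: "x \<in> {a<..<b}"
begin

text \<open>\<open>Lim\<close> is a definite description, so the existence of the limit, here by
  monotonicity, has to precede any use of its value.\<close>

lemma v_tendsto_right: "(v \<longlongrightarrow> Lim (at_right x) v) (at_right x)"
proof -
  have "(v \<longlongrightarrow> Inf (v ` ({x<..} \<inter> {a..b}))) (at x within ({x<..} \<inter> {a..b}))"
    using x by (intro Lim_right_bound[where K = "v x"] v_mono) auto
  also have "at x within ({x<..} \<inter> {a..b}) = at_right x"
    using x by (intro at_within_nhd[of x "{a<..<b}"]) auto
  finally show ?thesis
    by (metis tendsto_Lim trivial_limit_at_right_real)
qed

lemma v_tendsto_left: "(v \<longlongrightarrow> Lim (at_left x) v) (at_left x)"
proof -
  have "(v \<longlongrightarrow> Sup (v ` ({..<x} \<inter> {a..b}))) (at x within ({..<x} \<inter> {a..b}))"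
    using x by (intro Lim_left_bound[where K = "v x"] v_mono) auto
  also have "at x within ({..<x} \<inter> {a..b}) = at_left x"
    using x by (intro at_within_nhd[of x "{a<..<b}"]) auto
  finally show ?thesis
    by (metis tendsto_Lim trivial_limit_at_left_real)
qed

lemma eventually_at_right_interval: "x < t \<Longrightarrow> \<forall>\<^sub>F u in at_right x. u \<in> {x<..<t}"
  by (auto simp: eventually_at_right_field)

lemma eventually_at_left_interval: "t < x \<Longrightarrow> \<forall>\<^sub>F u in at_left x. u \<in> {t<..<x}"
  by (auto simp: eventually_at_left_field)

lemma v_right_le: "t \<in> {x<..b} \<Longrightarrow> Lim (at_right x) v \<le> v t"
  using x eventually_at_right_interval[of t]
  by (intro tendsto_upperbound[OF v_tendsto_right]) (auto elim!: eventually_mono intro!: v_mono)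

lemma v_left_ge: "t \<in> {a..<x} \<Longrightarrow> v t \<le> Lim (at_left x) v"
  using x eventually_at_left_interval[of t]
  by (intro tendsto_lowerbound[OF v_tendsto_left]) (auto elim!: eventually_mono intro!: v_mono)

lemma v_right_ge: "v a \<le> Lim (at_right x) v"
  using x eventually_at_right_interval[of b]
  by (intro tendsto_lowerbound[OF v_tendsto_right]) (auto elim!: eventually_mono intro!: v_mono)

lemma v_left_le: "Lim (at_left x) v \<le> v b"
  using x eventually_at_left_interval[of a]
  by (intro tendsto_upperbound[OF v_tendsto_left]) (auto elim!: eventually_mono intro!: v_mono)

text \<open>The modulus is a real supremum and dominates its terms only because
  \<open>v b - v a\<close> bounds all of them.\<close>

lemma quasi_modulus_right_ge:
  assumes "t \<in> {x<..b}" "t \<le> x + \<delta>"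
  shows "v t - Lim (at_right x) v \<le> quasi_modulus a b v x \<delta>"
proof -
  have "bdd_above ((\<lambda>z. \<bar>Lim (at_right x) v - v z\<bar>) ` ({x<..x + \<delta>} \<inter> {a..b}))"
  proof (rule bdd_aboveI2)
    fix z assume "z \<in> {x<..x + \<delta>} \<inter> {a..b}"
    then show "\<bar>Lim (at_right x) v - v z\<bar> \<le> v b - v a"
      using v_right_le[of z] v_right_ge v_mono[of z b] a_less_b by auto
  qed
  then have "\<bar>Lim (at_right x) v - v t\<bar> \<le> quasi_modulus_right a b v x \<delta>"
    unfolding quasi_modulus_right_def using assms x by (intro cSUP_upper) auto
  then show ?thesis
    by (auto simp: quasi_modulus_def)
qed

lemma quasi_modulus_left_ge:
  assumes "t \<in> {a..<x}" "x - \<delta> \<le> t"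
  shows "Lim (at_left x) v - v t \<le> quasi_modulus a b v x \<delta>"
proof -
  have "bdd_above ((\<lambda>z. \<bar>Lim (at_left x) v - v z\<bar>) ` ({x - \<delta>..<x} \<inter> {a..b}))"
  proof (rule bdd_aboveI2)
    fix z assume "z \<in> {x - \<delta>..<x} \<inter> {a..b}"
    then show "\<bar>Lim (at_left x) v - v z\<bar> \<le> v b - v a"
      using v_left_ge[of z] v_left_le v_mono[of a z] a_less_b by auto
  qed
  then have "\<bar>Lim (at_left x) v - v t\<bar> \<le> quasi_modulus_left a b v x \<delta>"
    unfolding quasi_modulus_left_def using assms x by (intro cSUP_upper) auto
  then show ?thesis
    by (auto simp: quasi_modulus_def)
qed

lemma quasi_modulus_nonneg:
  assumes "0 < \<delta>"
  shows "0 \<le> quasi_modulus a b v x \<delta>"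
proof -
  have "min b (x + \<delta>) \<in> {x<..b}"
    using assms x by auto
  then show ?thesis
    using quasi_modulus_right_ge[of "min b (x + \<delta>)" \<delta>] v_right_le[of "min b (x + \<delta>)"] by auto
qed

lemma quasi_modulus_tendsto_0: "((\<lambda>\<delta>. quasi_modulus a b v x \<delta>) \<longlongrightarrow> 0) (at_right 0)"
proof (rule order_tendstoI)
  fix e :: real assume "e < 0"
  then show "\<forall>\<^sub>F \<delta> in at_right 0. e < quasi_modulus a b v x \<delta>"
    using eventually_at_right_less[of "0::real"]
    by (auto elim!: eventually_mono dest: quasi_modulus_nonneg)
next
  fix e :: real assume "0 < e"
  then have "\<forall>\<^sub>F t in at_right x. \<bar>Lim (at_right x) v - v t\<bar> < e / 2"
    "\<forall>\<^sub>F t in at_left x. \<bar>Lim (at_left x) v - v t\<bar> < e / 2"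
    using tendstoD[OF v_tendsto_right, of "e / 2"] tendstoD[OF v_tendsto_left, of "e / 2"]
    by (simp_all add: dist_real_def abs_minus_commute)
  then obtain u w where u: "x < u" "\<And>t. x < t \<Longrightarrow> t < u \<Longrightarrow> \<bar>Lim (at_right x) v - v t\<bar> < e / 2"
    and w: "w < x" "\<And>t. w < t \<Longrightarrow> t < x \<Longrightarrow> \<bar>Lim (at_left x) v - v t\<bar> < e / 2"
    unfolding eventually_at_right_field eventually_at_left_field by blast
  have "quasi_modulus a b v x \<delta> < e" if \<delta>: "0 < \<delta>" "\<delta> < min (u - x) (x - w)" for \<delta>
  proof -
    have "quasi_modulus_right a b v x \<delta> \<le> e / 2"
      unfolding quasi_modulus_right_def
    proof (rule cSUP_least)
      show "{x<..x + \<delta>} \<inter> {a..b} \<noteq> {}"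
        using x \<delta> by (auto intro!: exI[of _ "min b (x + \<delta>)"] simp: ex_in_conv[symmetric])
    qed (use u \<delta> in \<open>auto intro!: less_imp_le\<close>)
    moreover have "quasi_modulus_left a b v x \<delta> \<le> e / 2"
      unfolding quasi_modulus_left_def
    proof (rule cSUP_least)
      show "{x - \<delta>..<x} \<inter> {a..b} \<noteq> {}"
        using x \<delta> by (auto intro!: exI[of _ "max a (x - \<delta>)"] simp: ex_in_conv[symmetric])
    qed (use w \<delta> in \<open>auto intro!: less_imp_le\<close>)
    ultimately show ?thesis
      using \<open>0 < e\<close> by (simp add: quasi_modulus_def)
  qed
  then show "\<forall>\<^sub>F \<delta> in at_right 0. quasi_modulus a b v x \<delta> < e"
    unfolding eventually_at_right_field using u(1) w(1)
    by (intro exI[of _ "min (u - x) (x - w)"]) auto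
qed

text \<open>On the right, the shift can be chosen so small that the shifted point remains beyond
  \<open>x\<close>, and it leaves no trace in the bound.\<close>

lemma selection_right_limit:
  assumes s: "s \<in> metric_selections N a b F"
  obtains r where "(s \<longlongrightarrow> r) (at_right x)" "N r \<le> B"
    "\<And>t. t \<in> {x<..b} \<Longrightarrow> N (s t - r) \<le> v t - Lim (at_right x) v"
proof (rule one_sided_limit[OF s trivial_limit_at_right_real])
  show "\<forall>\<^sub>F t in at_right x. t \<in> {x<..b}" "{x<..b} \<subseteq> {a..b}"
    using x eventually_at_right_interval[of b] by (auto elim: eventually_mono)
  show "((\<lambda>t. v t - Lim (at_right x) v) \<longlongrightarrow> 0) (at_right x)"
    by (rule LIM_zero[OF v_tendsto_right])
  fix t assume t: "t \<in> {x<..b}"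
  show "\<forall>\<^sub>F u in at_right x. N (s t - s u) \<le> v t - Lim (at_right x) v"
    using eventually_at_right_interval[of t]
  proof (rule eventually_mono)
    fix u assume u: "u \<in> {x<..<t}"
    \<comment> \<open>Half the distance from \<open>u\<close> to \<open>x\<close>: at
      \<open>z\<close>, still to the right of \<open>x\<close>, \<open>v\<close> is at least its
      right limit.\<close>
    define z where "z = max a (u - (u - x) / 2)"
    have "z \<in> {x<..b}"
      using u t x by (auto simp: z_def max_def field_simps)
    then have "Lim (at_right x) v \<le> v z"
      by (rule v_right_le)
    moreover have "N (s t - s u) \<le> v t - v z"
      unfolding z_def using u t x by (intro selection_le_v[OF s]) auto
    ultimately show "N (s t - s u) \<le> v t - Lim (at_right x) v"
      by simp
  qed (use t in auto)
qed (use that in blast)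

text \<open>
  From the left, the majorant has to be evaluated at a point strictly below \<open>t\<close>, because a chain
  function at \<open>t\<close> takes a value of \<open>F\<close> at an earlier node; this is why \<open>2 * \<delta>\<close> appears in the theorem.
\<close>

lemma selection_left_limit:
  assumes s: "s \<in> metric_selections N a b F"
  obtains l where "(s \<longlongrightarrow> l) (at_left x)" "N l \<le> B"
    "\<And>t. t \<in> {a..<x} \<Longrightarrow> N (s t - l) \<le> Lim (at_left x) v - v (max a (2 * t - x))"
proof (rule one_sided_limit[OF s trivial_limit_at_left_real])
  show "\<forall>\<^sub>F t in at_left x. t \<in> {a..<x}" "{a..<x} \<subseteq> {a..b}"
    using x eventually_at_left_interval[of a] by (auto elim: eventually_mono)
  \<comment> \<open>The shifted point approaches \<open>x\<close> strictly from the left, so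
    \<open>v\<close> there has the same left limit and the bound tends to 0.\<close>
  have "((\<lambda>t. 2 * t - x) \<longlongrightarrow> 2 * x - x) (at_left x)"
    by (intro tendsto_intros)
  moreover have "\<forall>\<^sub>F t in at_left x. 2 * t - x < x"
    using eventually_at_left_interval[of a] x by (auto elim: eventually_mono)
  ultimately have "filterlim (\<lambda>t. 2 * t - x) (at_left x) (at_left x)"
    unfolding filterlim_at by (auto elim: eventually_mono)
  then have "((\<lambda>t. v (2 * t - x)) \<longlongrightarrow> Lim (at_left x) v) (at_left x)"
    by (rule filterlim_compose[OF v_tendsto_left])
  \<comment> \<open>The point \<open>2 * t - x\<close> exceeds \<open>a\<close> as soon as
    \<open>t\<close> exceeds the midpoint of \<open>a\<close> and \<open>x\<close>.\<close>
  moreover have "\<forall>\<^sub>F t in at_left x. v (2 * t - x) = v (max a (2 * t - x))"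
    using eventually_at_left_interval[of "(a + x) / 2"] x by (auto elim!: eventually_mono simp: max_def)
  ultimately have "((\<lambda>t. v (max a (2 * t - x))) \<longlongrightarrow> Lim (at_left x) v) (at_left x)"
    by (rule Lim_transform_eventually)
  from tendsto_diff[OF tendsto_const this, of "Lim (at_left x) v"]
  show "((\<lambda>t. Lim (at_left x) v - v (max a (2 * t - x))) \<longlongrightarrow> 0) (at_left x)"
    by simp
  fix t assume t: "t \<in> {a..<x}"
  show "\<forall>\<^sub>F u in at_left x. N (s t - s u) \<le> Lim (at_left x) v - v (max a (2 * t - x))"
    using eventually_at_left_interval[of t]
  proof (rule eventually_mono)
    fix u assume u: "u \<in> {t<..<x}"
    then have "v u \<le> Lim (at_left x) v"
      using t by (intro v_left_ge) auto
    \<comment> \<open>The shift is chosen as \<open>x - t\<close>: it vanishes as \<open>t\<close>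
      tends to \<open>x\<close>, and it doubles the distance from \<open>x\<close>.\<close>
    moreover have "N (s u - s t) \<le> v u - v (max a (t - (x - t)))"
      using u t x by (intro selection_le_v[OF s]) auto
    ultimately show "N (s t - s u) \<le> Lim (at_left x) v - v (max a (2 * t - x))"
      by (simp add: N_diff_commute[of "s t"])
  qed (use t in auto)
qed (use that in blast)

end

end

section \<open>The error estimate, for one selection and for the Hausdorff distance\<close>

text \<open>A real supremum of an unbounded set carries no sign information; the closeness
  hypothesis supplies the boundedness. Nonnegativity turns the upper bound into convergence to
  0.\<close>

lemma (in norm_on) haus_nonneg_if_close:
  assumes "A \<noteq> {}" "B \<noteq> {}" and close: "\<And>p. p \<in> A \<Longrightarrow> \<exists>q\<in>B. N (p - q) \<le> C"
  shows "0 \<le> haus N A B"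
proof -
  obtain p where "p \<in> A"
    using assms(1) by blast
  have "bdd_above ((\<lambda>p. point_dist N p B) ` A)"
  proof (rule bdd_aboveI2)
    fix p assume "p \<in> A"
    then show "point_dist N p B \<le> C"
      using close point_dist_le order_trans by blast
  qed
  then have "point_dist N p B \<le> (SUP p\<in>A. point_dist N p B)"
    using \<open>p \<in> A\<close> by (intro cSUP_upper)
  then show ?thesis
    using point_dist_nonneg[OF assms(2), of p] by (simp add: haus_def)
qed

context set_bv
begin

lemma selection_integrable:
  assumes \<kappa>: "bounded_variation dist a b \<kappa>" and s: "s \<in> metric_selections N a b F"
  shows "(\<lambda>t. \<kappa> t *\<^sub>R s t) integrable_on {a..b}"
proof -
  obtain n p y where npy: "chain_seq N a b F n p y"
    and lim: "\<And>t. t \<in> {a..b} \<Longrightarrow> (\<lambda>k. chain_seq.c n p y k t) \<longlonglongrightarrow> s t"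
    using metric_selectionE[OF s] by blast
  interpret chain_seq N a b F n p y by (rule npy)
  show ?thesis
    by (rule integrable_limit[OF \<kappa> lim])
qed

context
  fixes x \<delta> :: real and \<kappa> :: "real \<Rightarrow> real"
  assumes x: "x \<in> {a<..<b}" and \<delta>: "0 < \<delta>" and \<kappa>: "bounded_variation dist a b \<kappa>"
begin

text \<open>The right-hand side of (i) with the integral of \<open>\<bar>\<kappa> t\<bar>\<close> in
  place of \<open>M x\<close>, and with half the constants at the modulus and at the tail.\<close>

definition error_bound :: real where
  "error_bound =
     quasi_modulus a b v x (2 * \<delta>) * integral {a..b} (\<lambda>t. \<bar>\<kappa> t\<bar>)
     + B * (2 * integral {t \<in> {a..b}. \<bar>x - t\<bar> \<ge> \<delta>} (\<lambda>t. \<bar>\<kappa> t\<bar>)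
            + \<bar>integral {a..b} \<kappa> - 1\<bar> + \<bar>integral {a..b} (\<lambda>t. \<kappa> t * sgn (t - x))\<bar>)"

lemma tail_integral:
  "((\<lambda>t. if \<delta> \<le> \<bar>x - t\<bar> then \<bar>\<kappa> t\<bar> else 0) has_integral
     integral {t \<in> {a..b}. \<bar>x - t\<bar> \<ge> \<delta>} (\<lambda>t. \<bar>\<kappa> t\<bar>)) {a..b}"
  using x \<delta> by (intro has_integral_outside_ball bounded_variation_abs_integrable[OF \<kappa>]) auto

text \<open>
  Subtract from \<open>s\<close> the step function with the values \<open>s(x-)\<close> and \<open>s(x+)\<close>: the remainder is small
  near \<open>x\<close>, and the step function is the midpoint plus a multiple of \<open>sgn (t - x)\<close>.
\<close>

lemma selection_estimate:
  assumes s: "s \<in> metric_selections N a b F"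
  shows "N (integral {a..b} (\<lambda>t. \<kappa> t *\<^sub>R s t)
            - (1/2) *\<^sub>R (Lim (at_right x) s + Lim (at_left x) s)) \<le> error_bound"
proof -
  obtain r where r: "(s \<longlongrightarrow> r) (at_right x)" "N r \<le> B"
    "\<And>t. t \<in> {x<..b} \<Longrightarrow> N (s t - r) \<le> v t - Lim (at_right x) v"
    using selection_right_limit[OF x s] by blast
  obtain l where l: "(s \<longlongrightarrow> l) (at_left x)" "N l \<le> B"
    "\<And>t. t \<in> {a..<x} \<Longrightarrow> N (s t - l) \<le> Lim (at_left x) v - v (max a (2 * t - x))"
    using selection_left_limit[OF x s] by blast
  have Lim_eq: "Lim (at_right x) s = r" "Lim (at_left x) s = l"
    using r(1) l(1) by (auto intro: tendsto_Lim)
  define m where "m = (1/2) *\<^sub>R (r + l)"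
  define d where "d = (1/2) *\<^sub>R (r - l)"
  define w where "w = quasi_modulus a b v x (2 * \<delta>)"
  define \<beta> where "\<beta> = integral {t \<in> {a..b}. \<bar>x - t\<bar> \<ge> \<delta>} (\<lambda>t. \<bar>\<kappa> t\<bar>)"
  define f where "f t = \<kappa> t *\<^sub>R s t - \<kappa> t *\<^sub>R m - (\<kappa> t * sgn (t - x)) *\<^sub>R d" for t
  \<comment> \<open>The value at \<open>x\<close> makes the pointwise bound hold there too, where
    \<open>s x\<close> need not be near either one-sided limit; one point does not change the
    integral.\<close>
  define g where "g t = (if t = x then N (f x) else w * \<bar>\<kappa> t\<bar> + 2 * B * (if \<delta> \<le> \<bar>x - t\<bar> then \<bar>\<kappa> t\<bar> else 0))"
    for t
  have w0: "0 \<le> w"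
    unfolding w_def using \<delta> by (intro quasi_modulus_nonneg[OF x]) simp
  have m_le: "N m \<le> B" and d_le: "N d \<le> B"
    using N_add[of r l] N_diff[of r l] r(2) l(2) by (auto simp: m_def d_def N_scaleR)
  have md: "m + d = r" "m - d = l"
    by (simp_all add: m_def d_def scaleR_right_distrib scaleR_right_diff_distrib flip: scaleR_left_distrib)
  have sgn_int: "(\<lambda>t. \<kappa> t * sgn (t - x)) integrable_on {a..b}"
    using x by (intro integrable_mult_sgn bounded_variation_integrable[OF \<kappa>]) auto
  have f_int: "(f has_integral integral {a..b} (\<lambda>t. \<kappa> t *\<^sub>R s t) - integral {a..b} \<kappa> *\<^sub>R m
      - integral {a..b} (\<lambda>t. \<kappa> t * sgn (t - x)) *\<^sub>R d) {a..b}"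
    unfolding f_def
    by (intro has_integral_diff has_integral_scaleR_left integrable_integral sgn_int
        selection_integrable[OF \<kappa> s] bounded_variation_integrable[OF \<kappa>])
  have "((\<lambda>t. w * \<bar>\<kappa> t\<bar> + 2 * B * (if \<delta> \<le> \<bar>x - t\<bar> then \<bar>\<kappa> t\<bar> else 0)) has_integral
      w * integral {a..b} (\<lambda>t. \<bar>\<kappa> t\<bar>) + 2 * B * \<beta>) {a..b}"
    unfolding \<beta>_def
    by (intro has_integral_add has_integral_mult_right integrable_integral tail_integral
        bounded_variation_abs_integrable[OF \<kappa>])
  then have g_int: "(g has_integral w * integral {a..b} (\<lambda>t. \<bar>\<kappa> t\<bar>) + 2 * B * \<beta>) {a..b}"
    by (rule has_integral_spike_finite[of "{x}", rotated 2]) (auto simp: g_def)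
  have near: "N (s t - u) \<le> (if \<delta> \<le> \<bar>x - t\<bar> then 2 * B else w)"
    if t: "t \<in> {a..b}" "t \<noteq> x" and u: "u = (if t < x then l else r)" for t u
  proof (cases "\<delta> \<le> \<bar>x - t\<bar>")
    case True
    then show ?thesis
      using N_diff[of "s t" u] N_le_sup_norm[OF t(1) selection_in_F[OF s t(1)]] r(2) l(2) u by auto
  next
    case False
    show ?thesis
    proof (cases "t < x")
      case True
      \<comment> \<open>\<open>t\<close> is within \<delta> of \<open>x\<close>, so
        \<open>2 * t - x\<close> is within \<open>2 * \<delta>\<close>, the radius in
        \<open>w\<close>.\<close>
      then have "Lim (at_left x) v - v (max a (2 * t - x)) \<le> w"
        unfolding w_def using False t x by (intro quasi_modulus_left_ge[OF x]) auto
      then show ?thesis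
        using l(3)[of t] False True t u by auto
    next
      case tx: False
      then have "v t - Lim (at_right x) v \<le> w"
        unfolding w_def using False t x by (intro quasi_modulus_right_ge[OF x]) auto
      then show ?thesis
        using r(3)[of t] False tx t u by auto
    qed
  qed
  have le: "N (f t) \<le> g t" if t: "t \<in> {a..b}" for t
  proof (cases "t = x")
    case True
    then show ?thesis by (simp add: g_def)
  next
    case False
    define u where "u = (if t < x then l else r)"
    have "f t = \<kappa> t *\<^sub>R (s t - u)"
      using False md by (auto simp: f_def u_def sgn_if scaleR_right_diff_distrib scaleR_right_distrib
          simp flip: md)
    then have "N (f t) = \<bar>\<kappa> t\<bar> * N (s t - u)"
      by (simp add: N_scaleR)
    also have "\<dots> \<le> \<bar>\<kappa> t\<bar> * (if \<delta> \<le> \<bar>x - t\<bar> then 2 * B else w)"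
      by (intro mult_left_mono near[OF t False u_def]) simp
    \<comment> \<open>\<open>g\<close> carries the term with \<open>w\<close> away from
      \<open>x\<close> as well, which is harmless as \<open>0 \<le> w\<close> and produces the
      integral of \<open>\<bar>\<kappa> t\<bar>\<close> over all of [a, b].\<close>
    also have "\<dots> \<le> g t"
      using False w0 by (auto simp: g_def mult_ac)
    finally show ?thesis .
  qed
  have "N (integral {a..b} f) \<le> integral {a..b} g"
    using f_int g_int le by (intro N_integral_le) auto
  moreover have "N ((integral {a..b} \<kappa> - 1) *\<^sub>R m) \<le> \<bar>integral {a..b} \<kappa> - 1\<bar> * B"
    unfolding N_scaleR by (intro mult_left_mono m_le) simp
  moreover have "N (integral {a..b} (\<lambda>t. \<kappa> t * sgn (t - x)) *\<^sub>R d)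
      \<le> \<bar>integral {a..b} (\<lambda>t. \<kappa> t * sgn (t - x))\<bar> * B"
    unfolding N_scaleR by (intro mult_left_mono d_le) simp
  \<comment> \<open>The constant part of the step function integrates to
    \<open>integral {a..b} \<kappa> *\<^sub>R m\<close> instead of \<open>m\<close>, the defect that
    \<open>alpha\<close> measures; the jump part gives the sign integral times
    \<open>d\<close>.\<close>
  moreover have "integral {a..b} (\<lambda>t. \<kappa> t *\<^sub>R s t) - m = integral {a..b} f
      + ((integral {a..b} \<kappa> - 1) *\<^sub>R m + integral {a..b} (\<lambda>t. \<kappa> t * sgn (t - x)) *\<^sub>R d)"
    using integral_unique[OF f_int] by (simp add: algebra_simps)
  then have "N (integral {a..b} (\<lambda>t. \<kappa> t *\<^sub>R s t) - m) \<le> N (integral {a..b} f)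
      + (N ((integral {a..b} \<kappa> - 1) *\<^sub>R m) + N (integral {a..b} (\<lambda>t. \<kappa> t * sgn (t - x)) *\<^sub>R d))"
    using order_trans[OF N_add add_left_mono[OF N_add]] by simp
  ultimately have "N (integral {a..b} (\<lambda>t. \<kappa> t *\<^sub>R s t) - m) \<le> w * integral {a..b} (\<lambda>t. \<bar>\<kappa> t\<bar>) + 2 * B * \<beta>
      + (\<bar>integral {a..b} \<kappa> - 1\<bar> * B + \<bar>integral {a..b} (\<lambda>t. \<kappa> t * sgn (t - x))\<bar> * B)"
    using integral_unique[OF g_int] by linarith
  then show ?thesis
    by (simp add: Lim_eq m_def error_bound_def w_def \<beta>_def algebra_simps)
qed

text \<open>Both sets are images of the set of selections, so a point of either is matched with the
  point of the other that comes from the same \<open>s\<close>.\<close>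

lemma
  shows haus_weighted_metric_integral_le:
      "haus N (weighted_metric_integral N a b \<kappa> F) (A_set N a b F x) \<le> error_bound"
    and haus_weighted_metric_integral_nonneg:
      "0 \<le> haus N (weighted_metric_integral N a b \<kappa> F) (A_set N a b F x)"
proof -
  have A_eq: "A_set N a b F x =
      (\<lambda>s. (1/2) *\<^sub>R (Lim (at_right x) s + Lim (at_left x) s)) ` metric_selections N a b F"
    by (auto simp: A_set_def)
  have close: "\<exists>q\<in>A_set N a b F x. N (p - q) \<le> error_bound"
    if "p \<in> weighted_metric_integral N a b \<kappa> F" for p
    using that selection_estimate unfolding A_eq weighted_metric_integral_eq[OF \<kappa>] by blast
  have close': "\<exists>p\<in>weighted_metric_integral N a b \<kappa> F. N (q - p) \<le> error_bound"
    if "q \<in> A_set N a b F x" for q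
    using that selection_estimate N_diff_commute unfolding A_eq weighted_metric_integral_eq[OF \<kappa>]
    by fastforce
  have ne: "weighted_metric_integral N a b \<kappa> F \<noteq> {}" "A_set N a b F x \<noteq> {}"
    using metric_selections_nonempty by (auto simp: A_eq weighted_metric_integral_eq[OF \<kappa>])
  show "haus N (weighted_metric_integral N a b \<kappa> F) (A_set N a b F x) \<le> error_bound"
    by (rule haus_le[OF ne close close'])
  show "0 \<le> haus N (weighted_metric_integral N a b \<kappa> F) (A_set N a b F x)"
    by (rule haus_nonneg_if_close[OF ne close])
qed

end

end

theorem theorem4p3:
  fixes N :: "'a::euclidean_space \<Rightarrow> real"
    and a b x :: real
    and F :: "real \<Rightarrow> 'a set"
    and K :: "nat \<Rightarrow> real \<Rightarrow> real \<Rightarrow> real"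
    and M :: "real \<Rightarrow> ennreal"
  assumes "is_norm N"
    and "F \<in> class_F N a b"
    and "\<And>n u. u \<in> {a..b} \<Longrightarrow> bounded_variation dist a b (\<lambda>t. K n u t)"
    and "\<And>n u. u \<in> {a..b} \<Longrightarrow> ennreal (integral {a..b} (\<lambda>t. \<bar>K n u t\<bar>)) \<le> M u"
    and "x \<in> {a<..<b}"
  shows "(\<forall>\<delta>>0. \<forall>n.
            ennreal (haus N (T_set N a b K n F x) (A_set N a b F x))
              \<le> 2 * ennreal (quasi_modulus a b (var_fun N a F) x (2 * \<delta>)) * M x
                + ennreal (sup_norm N a b F *
                    (4 * beta a b K n x \<delta> + alpha a b K n x
                      + \<bar>T_real a b K n (\<lambda>t. sgn (t - x)) x\<bar>)))
       \<and> (((\<lambda>n. alpha a b K n x) \<longlonglongrightarrow> 0)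
            \<and> (\<forall>\<^sub>F \<delta> in at_right 0. (\<lambda>n. beta a b K n x \<delta>) \<longlonglongrightarrow> 0)
            \<and> ((\<lambda>n. T_real a b K n (\<lambda>t. sgn (t - x)) x) \<longlonglongrightarrow> 0)
            \<and> M x < \<infinity>
          \<longrightarrow> (\<lambda>n. haus N (T_set N a b K n F x) (A_set N a b F x)) \<longlonglongrightarrow> 0)"
proof -
  interpret set_bv N a b F
    using assms(1,2,5) by unfold_locales auto
  define H where "H n = haus N (T_set N a b K n F x) (A_set N a b F x)" for n
  define w where "w \<delta> = quasi_modulus a b v x \<delta>" for \<delta>
  define I where "I n = integral {a..b} (\<lambda>t. \<bar>K n x t\<bar>)" for n
  define R where "R c \<delta> n = B * (c * beta a b K n x \<delta> + alpha a b K n x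
      + \<bar>T_real a b K n (\<lambda>t. sgn (t - x)) x\<bar>)" for c \<delta> n
  have x_in: "x \<in> {a..b}"
    using assms(5) by auto
  have bv: "bounded_variation dist a b (K n x)" for n
    using assms(3)[OF x_in] .
  \<comment> \<open>The assertion does not involve \<delta>; the value 1 is an arbitrary positive
    choice.\<close>
  have H_nonneg: "0 \<le> H n" for n
    unfolding H_def T_set_def
    by (rule haus_weighted_metric_integral_nonneg[OF assms(5) zero_less_one bv])
  have H_le: "H n \<le> w (2 * \<delta>) * I n + R 2 \<delta> n" if "0 < \<delta>" for \<delta> n
    using haus_weighted_metric_integral_le[OF assms(5) that bv[of n]]
    by (simp add: H_def T_set_def error_bound_def[OF assms(5) that bv] w_def I_def R_def beta_def
        alpha_def T_real_def)
  have w_nonneg: "0 \<le> w \<delta>" if "0 < \<delta>" for \<delta>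
    unfolding w_def by (rule quasi_modulus_nonneg[OF assms(5) that])
  have I_nonneg: "0 \<le> I n" for n
    unfolding I_def by (intro integral_nonneg bounded_variation_abs_integrable bv) auto
  have beta_nonneg: "0 \<le> beta a b K n x \<delta>" if "0 < \<delta>" for n \<delta>
    unfolding beta_def by (rule has_integral_nonneg[OF tail_integral[OF assms(5) that bv]]) auto
  have I_le_M: "ennreal (I n) \<le> M x" for n
    unfolding I_def by (rule assms(4)[OF x_in])
  show ?thesis
    unfolding H_def[symmetric] w_def[symmetric] R_def[symmetric]
  proof (intro conjI allI impI)
    fix \<delta> :: real and n assume "0 < \<delta>"
    then have nonneg: "0 \<le> w (2 * \<delta>) * I n" "0 \<le> R 2 \<delta> n" "R 2 \<delta> n \<le> R 4 \<delta> n"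
      using w_nonneg[of "2 * \<delta>"] I_nonneg[of n] beta_nonneg[of \<delta> n] sup_norm_nonneg
      by (auto simp: R_def alpha_def intro!: mult_nonneg_nonneg mult_left_mono)
    have "ennreal (H n) \<le> ennreal (2 * (w (2 * \<delta>) * I n) + R 4 \<delta> n)"
      using H_le[OF \<open>0 < \<delta>\<close>, of n] nonneg by (intro ennreal_leI) linarith
    also have "\<dots> = 2 * ennreal (w (2 * \<delta>)) * ennreal (I n) + ennreal (R 4 \<delta> n)"
      using nonneg w_nonneg[of "2 * \<delta>"] I_nonneg[of n] \<open>0 < \<delta>\<close>
      by (simp add: ennreal_plus ennreal_mult ennreal_numeral mult.assoc)
    \<comment> \<open>\<open>M x\<close> enters only here, by monotonicity from the finite
      \<open>I n\<close>; this covers \<open>M x = \<infinity>\<close> too, also when the modulus is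
      0 and the product is 0 in \<open>ennreal\<close>.\<close>
    also have "\<dots> \<le> 2 * ennreal (w (2 * \<delta>)) * M x + ennreal (R 4 \<delta> n)"
      by (intro add_right_mono mult_left_mono I_le_M) simp
    finally show "ennreal (H n) \<le> 2 * ennreal (w (2 * \<delta>)) * M x + ennreal (R 4 \<delta> n)" .
  next
    assume lim: "(\<lambda>n. alpha a b K n x) \<longlonglongrightarrow> 0 \<and>
      (\<forall>\<^sub>F \<delta> in at_right 0. (\<lambda>n. beta a b K n x \<delta>) \<longlonglongrightarrow> 0) \<and>
      (\<lambda>n. T_real a b K n (\<lambda>t. sgn (t - x)) x) \<longlonglongrightarrow> 0 \<and> M x < \<infinity>"
    define m where "m = enn2real (M x)"
    have I_le: "I n \<le> m" for n
      using I_le_M[of n] lim I_nonneg[of n] unfolding m_def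
      by (metis enn2real_ennreal enn2real_mono infinity_ennreal_def)
    show "H \<longlonglongrightarrow> 0"
    proof (rule order_tendstoI)
      fix e :: real assume "e < 0"
      then show "\<forall>\<^sub>F n in sequentially. e < H n"
        using H_nonneg by (auto intro: always_eventually less_le_trans)
    next
      fix e :: real assume "0 < e"
      \<comment> \<open>\<delta> is fixed before \<open>n\<close>: the modulus term becomes smaller
        than \<open>e\<close> uniformly in \<open>n\<close> because \<open>I n \<le> m\<close>, and
        for this \<delta> the remaining terms tend to 0.\<close>
      have "filterlim (\<lambda>\<delta>::real. 2 * \<delta>) (at_right 0) (at_right 0)"
        by real_asymp
      then have "((\<lambda>\<delta>. w (2 * \<delta>) * m) \<longlongrightarrow> 0 * m) (at_right 0)"
        unfolding w_def
        by (intro tendsto_mult tendsto_const filterlim_compose[OF quasi_modulus_tendsto_0[OF assms(5)]])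
      then have "\<forall>\<^sub>F \<delta> in at_right 0. w (2 * \<delta>) * m < e"
        using \<open>0 < e\<close> by (intro order_tendstoD) auto
      then have "\<forall>\<^sub>F \<delta> in at_right 0. w (2 * \<delta>) * m < e \<and> (\<lambda>n. beta a b K n x \<delta>) \<longlonglongrightarrow> 0 \<and> 0 < \<delta>"
        using lim eventually_at_right_less[of "0::real"] by (auto simp: eventually_conj_iff)
      then obtain \<delta> where \<delta>: "w (2 * \<delta>) * m < e" "(\<lambda>n. beta a b K n x \<delta>) \<longlonglongrightarrow> 0" "0 < \<delta>"
        using eventually_happens'[OF trivial_limit_at_right_real] by blast
      have "(\<lambda>n. w (2 * \<delta>) * m + R 2 \<delta> n) \<longlonglongrightarrow> w (2 * \<delta>) * m + B * (2 * 0 + 0 + \<bar>0\<bar>)"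
        unfolding R_def using lim \<delta>(2) by (intro tendsto_intros) auto
      then have "\<forall>\<^sub>F n in sequentially. w (2 * \<delta>) * m + R 2 \<delta> n < e"
        using \<delta>(1) by (intro order_tendstoD) auto
      then show "\<forall>\<^sub>F n in sequentially. H n < e"
      proof eventually_elim
        case (elim n)
        have "w (2 * \<delta>) * I n \<le> w (2 * \<delta>) * m"
          using w_nonneg[of "2 * \<delta>"] \<delta>(3) by (intro mult_left_mono I_le) simp
        then show ?case
          using elim H_le[OF \<delta>(3), of n] by linarith
      qed
    qed
  qed
qed

end
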